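(* Let $f$ be $\mu$-strongly convex ($\mu>0$) and $L$-smooth on the domain. Then for AdaAFW and AdaPFW (with $\mathrm{conv}(\mathcal A)$ a polytope) or AdaMP (all described in the context), for each good step $t$, $$h_{t+1}\le(1-\delta^2\rho_t)\,h_t,$$ where $$\rho_t=\frac{\mu}{4L_t}\Big(\frac{\mathrm{PWidth}(\mathcal A)}{\mathrm{diam}(\mathcal A)}\Big)^2\ \text{ for AdaAFW and AdaPFW},\qquad \rho_t=\frac{\mu}{L_t}\Big(\frac{\mathrm{mDW}(\mathcal B)}{\mathrm{radius}(\mathcal B)}\Big)^2\ \text{ for AdaMP},$$ with $\mathcal B=\mathcal A\cup(-\mathcal A)$.
   Context: Setting. $\mathcal A\subset\mathbb R^p$ is a nonempty bounded (possibly infinite) set of "atoms" (not reduced to one point for AdaAFW/AdaPFW, not equal to $\{0\}$ for AdaMP), $\mathrm{conv}(\mathcal A)$ its convex hull, $\mathrm{lin}(\mathcal A)$ its linear span, $\mathcal B=\mathcal A\cup(-\mathcal A)$. $\|\cdot\|$ is the Euclidean norm, $\mathrm{diam}(\mathcal A)=\sup_{x,y\in\mathcal A}\|x-y\|$, $\mathrm{radius}(\mathcal B)=\sup_{a\in\mathcal B}\|a\|$. $f:\mathbb R^p\to\mathbb R$ is differentiable, $L$-smooth on the domain $D$ (i.e. $\|\nabla f(x)-\nabla f(y)\|\le L\|x-y\|$ for $x,y\in D$) and $\mu$-strongly convex (i.e. $f-\frac\mu2\|\cdot\|^2$ is convex), where $D=\mathrm{conv}(\mathcal A)$ for AdaAFW,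 AdaPFW and $D=\mathrm{lin}(\mathcal A)$ for AdaMP. $h_t=f(x_t)-\min_{x\in D}f(x)$. Minima and maxima that are written are assumed to be attained (or read as infima/suprema). Geometric constants. For $x\in\mathrm{conv}(\mathcal A)$ let $\mathcal S_x$ be the collection of all $\mathcal S\subseteq\mathcal A$ such that $x$ is a proper convex combination of all the elements of $\mathcal S$ (all coefficients positive, summing to 1). Pyramidal directional width: $\mathrm{PdirW}(\mathcal A,r,x)=\min_{\mathcal S\in\mathcal S_x}\max_{s\in\mathcal A,\,v\in\mathcal S}\langle r/\|r\|,s-v\rangle$. Pyramidal width: $\mathrm{PWidth}(\mathcal A)=\min\mathrm{PdirW}(\mathcal K\cap\mathcal A,r,x)$ over all faces $\mathcal K$ of $\mathrm{conv}(\mathcal A)$, $x\in\mathcal K$, $r\in\mathrm{cone}(\mathcal K-x)\setminus\{0\}$. Minimal directional width: $\mathrm{mDW}(\mathcal B)=\min_{d\in\mathrm{lin}(\mathcal B)\setminus\{0\}}\max_{z\in\mathcal B}\langle z,d\rangle/\|d\|$. Algorithms. Inputs: $x_0\in\mathcal A$, $L_{-1}>0$, tolerance $\varepsilon\ge 0$, subproblem quality $\delta\in(0,1]$, parameters $\tau>1$, $0<\eta\le1$. At iteration $t=0,1,\dots$: compute a direction $d_t$ and a maximal step-size $\gamma_t^{\max}$ (see below); set $g_t=\langle-\nabla f(x_t),d_t\rangle$; if $g_t\le\delta\varepsilon$, stop and return $x_t$. Otherwise choose any $M\in[\eta L_{t-1},L_{t-1}]$ and set $\gamma=\min\{g_t/(M\|d_t\|^2),\gamma_t^{\max}\}$;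 as long as the sufficient decrease condition $f(x_t+\gamma d_t)\le f(x_t)-\gamma g_t+\frac{\gamma^2M}{2}\|d_t\|^2$ fails, replace $M$ by $\tau M$ and recompute $\gamma=\min\{g_t/(M\|d_t\|^2),\gamma_t^{\max}\}$. When the condition holds, set $\gamma_t=\gamma$, $L_t=M$, $x_{t+1}=x_t+\gamma_td_t$. Directions. For AdaAFW and AdaPFW, $s_t\in\mathcal A$ is any atom with $\langle\nabla f(x_t),s_t-x_t\rangle\le\delta\min_{s\in\mathcal A}\langle\nabla f(x_t),s-x_t\rangle$; an active set $\mathcal S_t\subseteq\mathcal A$ and weights $\alpha_{v,t}>0$ ($v\in\mathcal S_t$, $\alpha_{v,t}=0$ otherwise) with $x_t=\sum_{v\in\mathcal S_t}\alpha_{v,t}v$, $\sum_v\alpha_{v,t}=1$, are maintained, starting from $\mathcal S_0=\{x_0\}$, $\alpha_{x_0,0}=1$; and $v_t\in\mathcal S_t$ is any element with $\langle\nabla f(x_t),x_t-v_t\rangle\le\delta\min_{v\in\mathcal S_t}\langle\nabla f(x_t),x_t-v\rangle$. - AdaAFW: if $\langle\nabla f(x_t),s_t-x_t\rangle\le\langle\nabla f(x_t),x_t-v_t\rangle$ then $d_t=s_t-x_t$, $\gamma_t^{\max}=1$ (FW step); otherwise $d_t=x_t-v_t$, $\gamma_t^{\max}=\alpha_{v_t,t}/(1-\alpha_{v_t,t})$ (away step). After a FW step, $\mathcal S_{t+1}=\{s_t\}$ if $\gamma_t=1$, else $\mathcal S_{t+1}=\mathcal S_t\cup\{s_t\}$,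 with $\alpha_{v,t+1}=(1-\gamma_t)\alpha_{v,t}$ for $v\in\mathcal S_t\setminus\{s_t\}$ and $\alpha_{s_t,t+1}=(1-\gamma_t)\alpha_{s_t,t}+\gamma_t$. After an away step, $\mathcal S_{t+1}=\mathcal S_t\setminus\{v_t\}$ if $\gamma_t=\gamma_t^{\max}$, else $\mathcal S_{t+1}=\mathcal S_t$, with $\alpha_{v,t+1}=(1+\gamma_t)\alpha_{v,t}$ for $v\in\mathcal S_t\setminus\{v_t\}$ and $\alpha_{v_t,t+1}=(1+\gamma_t)\alpha_{v_t,t}-\gamma_t$. - AdaPFW: $d_t=s_t-v_t$, $\gamma_t^{\max}=\alpha_{v_t,t}$. Then $\alpha_{s_t,t+1}=\alpha_{s_t,t}+\gamma_t$, $\alpha_{v_t,t+1}=\alpha_{v_t,t}-\gamma_t$, other weights unchanged; $\mathcal S_{t+1}=(\mathcal S_t\setminus\{v_t\})\cup\{s_t\}$ if $\alpha_{v_t,t+1}=0$, else $\mathcal S_{t+1}=\mathcal S_t\cup\{s_t\}$. - AdaMP: $s_t\in\mathcal B$ is any element with $\langle\nabla f(x_t),s_t\rangle\le\delta\min_{s\in\mathcal B}\langle\nabla f(x_t),s\rangle$; $d_t=s_t$, $\gamma_t^{\max}=+\infty$. Step $t$ is bad if $\gamma_t=\gamma_t^{\max}$ and $\gamma_t^{\max}<1$; otherwise it is good (so every AdaMP step is good). *)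

theory Defs
  imports "HOL-Analysis.Analysis"
begin

definition strongly_convex_on :: "real \<Rightarrow> 'a::euclidean_space set \<Rightarrow> ('a \<Rightarrow> real) \<Rightarrow> bool" where
  "strongly_convex_on \<mu> D f \<longleftrightarrow> convex_on D (\<lambda>x. f x - \<mu> / 2 * (norm x)\<^sup>2)"

definition primal_gap :: "('a::euclidean_space \<Rightarrow> real) \<Rightarrow> 'a set \<Rightarrow> 'a \<Rightarrow> real" where
  "primal_gap f D x = f x - (INF y\<in>D. f y)"

definition radius :: "'a::euclidean_space set \<Rightarrow> real" where
  "radius B = (SUP a\<in>B. norm a)"


section \<open>Geometric constants\<close>

text \<open>All minima and maxima are rendered as real infima and suprema, because the atom
  set may be infinite and need not be closed. The index sets are nonempty and bounded on the
  relevant side wherever the constants are used below.\<close>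

definition proper_supports :: "'a::euclidean_space set \<Rightarrow> 'a \<Rightarrow> 'a set set" where
  "proper_supports A x =
     {S. finite S \<and> S \<subseteq> A \<and>
         (\<exists>c. (\<forall>v\<in>S. 0 < c v) \<and> (\<Sum>v\<in>S. c v) = (1::real) \<and> (\<Sum>v\<in>S. c v *\<^sub>R v) = x)}"

definition PdirW :: "'a::euclidean_space set \<Rightarrow> 'a \<Rightarrow> 'a \<Rightarrow> real" where
  "PdirW A r x =
     (INF S\<in>proper_supports A x. SUP (s, v)\<in>A \<times> S. (r /\<^sub>R norm r) \<bullet> (s - v))"

definition PWidth :: "'a::euclidean_space set \<Rightarrow> real" where
  "PWidth A =
     (INF (K, x, r)\<in>{(K, x, r). K face_of (convex hull A) \<and> x \<in> K \<and>
                        r \<in> cone hull ((\<lambda>y. y - x) ` K) - {0}}.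
        PdirW (K \<inter> A) r x)"

definition mDW :: "'a::euclidean_space set \<Rightarrow> real" where
  "mDW B = (INF d\<in>span B - {0}. SUP z\<in>B. (z \<bullet> d) / norm d)"

definition symmetrize :: "'a::euclidean_space set \<Rightarrow> 'a set" where
  "symmetrize A = A \<union> uminus ` A"


section \<open>Adaptive step-size\<close>

text \<open>The maximal step-size is an extended real, since it is infinite for matching pursuit.\<close>

definition trial_step :: "'a::euclidean_space \<Rightarrow> real \<Rightarrow> ereal \<Rightarrow> real \<Rightarrow> real" where
  "trial_step d g gmax M = real_of_ereal (min (ereal (g / (M * (norm d)\<^sup>2))) gmax)"

definition sufficient_decrease ::
  "('a::euclidean_space \<Rightarrow> real) \<Rightarrow> 'a \<Rightarrow> 'a \<Rightarrow> real \<Rightarrow> real \<Rightarrow> real \<Rightarrow> bool" where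
  "sufficient_decrease f x d g M \<gamma> \<longleftrightarrow>
     f (x + \<gamma> *\<^sub>R d) \<le> f x - \<gamma> * g + \<gamma>\<^sup>2 * M / 2 * (norm d)\<^sup>2"

text \<open>The loop starts from an arbitrary \<open>M\<close> in the admissible interval and returns after
  \<open>k\<close> multiplications by \<open>\<tau>\<close>, at the first value for which the decrease condition holds.\<close>

definition backtracking ::
  "('a::euclidean_space \<Rightarrow> real) \<Rightarrow> real \<Rightarrow> real \<Rightarrow> real \<Rightarrow> 'a \<Rightarrow> 'a \<Rightarrow> real \<Rightarrow> ereal
     \<Rightarrow> real \<Rightarrow> real \<Rightarrow> bool" where
  "backtracking f \<tau> \<eta> Lprev x d g gmax Lnew \<gamma> \<longleftrightarrow>
     (\<exists>M\<in>{\<eta> * Lprev..Lprev}. \<exists>k.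
        (\<forall>j<k. \<not> sufficient_decrease f x d g (\<tau> ^ j * M) (trial_step d g gmax (\<tau> ^ j * M))) \<and>
        Lnew = \<tau> ^ k * M \<and>
        \<gamma> = trial_step d g gmax Lnew \<and>
        sufficient_decrease f x d g Lnew \<gamma>)"

text \<open>\<open>T\<close> is a number of iterations performed, possibly infinite. The run need not have
  reached its stopping test after \<open>T\<close> iterations, so every initial part of a run is a run.
  \<open>Lest t\<close> is the estimate accepted at iteration \<open>t\<close> and \<open>Linit\<close> is the initial one.\<close>

definition ada_run ::
  "('a::euclidean_space \<Rightarrow> real) \<Rightarrow> ('a \<Rightarrow> 'a) \<Rightarrow> 'a set \<Rightarrow> real \<Rightarrow> real \<Rightarrow> real \<Rightarrow> real \<Rightarrow> real
     \<Rightarrow> enat \<Rightarrow> (nat \<Rightarrow> 'a) \<Rightarrow> (nat \<Rightarrow> 'a) \<Rightarrow> (nat \<Rightarrow> ereal) \<Rightarrow> (nat \<Rightarrow> real) \<Rightarrow> (nat \<Rightarrow> real)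
     \<Rightarrow> bool" where
  "ada_run f grad A \<epsilon> \<delta> \<tau> \<eta> Linit T x d gmax \<gamma> Lest \<longleftrightarrow>
     x 0 \<in> A \<and>
     (\<forall>t. enat t < T \<longrightarrow>
        (let g = (- grad (x t)) \<bullet> d t;
             Lprev = (case t of 0 \<Rightarrow> Linit | Suc n \<Rightarrow> Lest n)
         in g > \<delta> * \<epsilon> \<and>
            backtracking f \<tau> \<eta> Lprev (x t) (d t) g (gmax t) (Lest t) (\<gamma> t) \<and>
            x (Suc t) = x t + \<gamma> t *\<^sub>R d t))"

definition good_step :: "ereal \<Rightarrow> real \<Rightarrow> bool" where
  "good_step gmax \<gamma> \<longleftrightarrow> \<not> (ereal \<gamma> = gmax \<and> gmax < 1)"


section \<open>Directions and active sets\<close>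

text \<open>The properties of the active set (that the weights are positive on it, sum to 1 and
  represent the iterate) are not assumed: they follow from the initialization and the updates.\<close>

definition active_init ::
  "(nat \<Rightarrow> 'a::euclidean_space) \<Rightarrow> (nat \<Rightarrow> 'a set) \<Rightarrow> (nat \<Rightarrow> 'a \<Rightarrow> real) \<Rightarrow> bool" where
  "active_init x S \<alpha> \<longleftrightarrow> S 0 = {x 0} \<and> \<alpha> 0 = (\<lambda>u. if u = x 0 then 1 else 0)"

definition fw_atom :: "('a::euclidean_space \<Rightarrow> 'a) \<Rightarrow> 'a set \<Rightarrow> real \<Rightarrow> 'a \<Rightarrow> 'a \<Rightarrow> bool" where
  "fw_atom grad A \<delta> x s \<longleftrightarrow>
     s \<in> A \<and> grad x \<bullet> (s - x) \<le> \<delta> * (INF a\<in>A. grad x \<bullet> (a - x))"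

definition away_atom :: "('a::euclidean_space \<Rightarrow> 'a) \<Rightarrow> 'a set \<Rightarrow> real \<Rightarrow> 'a \<Rightarrow> 'a \<Rightarrow> bool" where
  "away_atom grad S \<delta> x v \<longleftrightarrow>
     v \<in> S \<and> grad x \<bullet> (x - v) \<le> \<delta> * (INF u\<in>S. grad x \<bullet> (x - u))"

definition fw_step ::
  "'a::euclidean_space \<Rightarrow> 'a \<Rightarrow> 'a set \<Rightarrow> ('a \<Rightarrow> real) \<Rightarrow> 'a \<Rightarrow> ereal \<Rightarrow> real
     \<Rightarrow> 'a set \<Rightarrow> ('a \<Rightarrow> real) \<Rightarrow> bool" where
  "fw_step x s S \<alpha> d gmax \<gamma> S' \<alpha>' \<longleftrightarrow>
     d = s - x \<and> gmax = 1 \<and>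
     S' = (if \<gamma> = 1 then {s} else S \<union> {s}) \<and>
     \<alpha>' = (\<lambda>u. if u = s then (1 - \<gamma>) * \<alpha> u + \<gamma> else (1 - \<gamma>) * \<alpha> u)"

definition away_step ::
  "'a::euclidean_space \<Rightarrow> 'a \<Rightarrow> 'a set \<Rightarrow> ('a \<Rightarrow> real) \<Rightarrow> 'a \<Rightarrow> ereal \<Rightarrow> real
     \<Rightarrow> 'a set \<Rightarrow> ('a \<Rightarrow> real) \<Rightarrow> bool" where
  "away_step x v S \<alpha> d gmax \<gamma> S' \<alpha>' \<longleftrightarrow>
     d = x - v \<and> gmax = ereal (\<alpha> v / (1 - \<alpha> v)) \<and>
     S' = (if ereal \<gamma> = gmax then S - {v} else S) \<and>
     \<alpha>' = (\<lambda>u. if u = v then (1 + \<gamma>) * \<alpha> u - \<gamma> else (1 + \<gamma>) * \<alpha> u)"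

text \<open>A pairwise step is performed only if \<open>s \<noteq> v\<close>, since otherwise the direction is zero
  and the stopping test succeeds.\<close>

definition pairwise_step ::
  "'a::euclidean_space \<Rightarrow> 'a \<Rightarrow> 'a set \<Rightarrow> ('a \<Rightarrow> real) \<Rightarrow> 'a \<Rightarrow> ereal \<Rightarrow> real
     \<Rightarrow> 'a set \<Rightarrow> ('a \<Rightarrow> real) \<Rightarrow> bool" where
  "pairwise_step s v S \<alpha> d gmax \<gamma> S' \<alpha>' \<longleftrightarrow>
     d = s - v \<and> gmax = ereal (\<alpha> v) \<and>
     \<alpha>' = \<alpha>(s := \<alpha> s + \<gamma>, v := \<alpha> v - \<gamma>) \<and>
     S' = (if \<alpha>' v = 0 then (S - {v}) \<union> {s} else S \<union> {s})"

definition AdaAFW ::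
  "('a::euclidean_space \<Rightarrow> real) \<Rightarrow> ('a \<Rightarrow> 'a) \<Rightarrow> 'a set \<Rightarrow> real \<Rightarrow> real \<Rightarrow> real \<Rightarrow> real \<Rightarrow> real
     \<Rightarrow> enat \<Rightarrow> (nat \<Rightarrow> 'a) \<Rightarrow> (nat \<Rightarrow> 'a) \<Rightarrow> (nat \<Rightarrow> ereal) \<Rightarrow> (nat \<Rightarrow> real) \<Rightarrow> (nat \<Rightarrow> real)
     \<Rightarrow> (nat \<Rightarrow> 'a) \<Rightarrow> (nat \<Rightarrow> 'a) \<Rightarrow> (nat \<Rightarrow> 'a set) \<Rightarrow> (nat \<Rightarrow> 'a \<Rightarrow> real) \<Rightarrow> bool" where
  "AdaAFW f grad A \<epsilon> \<delta> \<tau> \<eta> Linit T x d gmax \<gamma> Lest s v S \<alpha> \<longleftrightarrow>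
     ada_run f grad A \<epsilon> \<delta> \<tau> \<eta> Linit T x d gmax \<gamma> Lest \<and>
     active_init x S \<alpha> \<and>
     (\<forall>t. enat t < T \<longrightarrow>
        fw_atom grad A \<delta> (x t) (s t) \<and>
        away_atom grad (S t) \<delta> (x t) (v t) \<and>
        (if grad (x t) \<bullet> (s t - x t) \<le> grad (x t) \<bullet> (x t - v t)
         then fw_step (x t) (s t) (S t) (\<alpha> t) (d t) (gmax t) (\<gamma> t) (S (Suc t)) (\<alpha> (Suc t))
         else away_step (x t) (v t) (S t) (\<alpha> t) (d t) (gmax t) (\<gamma> t) (S (Suc t)) (\<alpha> (Suc t))))"

definition AdaPFW ::
  "('a::euclidean_space \<Rightarrow> real) \<Rightarrow> ('a \<Rightarrow> 'a) \<Rightarrow> 'a set \<Rightarrow> real \<Rightarrow> real \<Rightarrow> real \<Rightarrow> real \<Rightarrow> real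
     \<Rightarrow> enat \<Rightarrow> (nat \<Rightarrow> 'a) \<Rightarrow> (nat \<Rightarrow> 'a) \<Rightarrow> (nat \<Rightarrow> ereal) \<Rightarrow> (nat \<Rightarrow> real) \<Rightarrow> (nat \<Rightarrow> real)
     \<Rightarrow> (nat \<Rightarrow> 'a) \<Rightarrow> (nat \<Rightarrow> 'a) \<Rightarrow> (nat \<Rightarrow> 'a set) \<Rightarrow> (nat \<Rightarrow> 'a \<Rightarrow> real) \<Rightarrow> bool" where
  "AdaPFW f grad A \<epsilon> \<delta> \<tau> \<eta> Linit T x d gmax \<gamma> Lest s v S \<alpha> \<longleftrightarrow>
     ada_run f grad A \<epsilon> \<delta> \<tau> \<eta> Linit T x d gmax \<gamma> Lest \<and>
     active_init x S \<alpha> \<and>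
     (\<forall>t. enat t < T \<longrightarrow>
        fw_atom grad A \<delta> (x t) (s t) \<and>
        away_atom grad (S t) \<delta> (x t) (v t) \<and>
        pairwise_step (s t) (v t) (S t) (\<alpha> t) (d t) (gmax t) (\<gamma> t) (S (Suc t)) (\<alpha> (Suc t)))"

definition AdaMP ::
  "('a::euclidean_space \<Rightarrow> real) \<Rightarrow> ('a \<Rightarrow> 'a) \<Rightarrow> 'a set \<Rightarrow> real \<Rightarrow> real \<Rightarrow> real \<Rightarrow> real \<Rightarrow> real
     \<Rightarrow> enat \<Rightarrow> (nat \<Rightarrow> 'a) \<Rightarrow> (nat \<Rightarrow> 'a) \<Rightarrow> (nat \<Rightarrow> ereal) \<Rightarrow> (nat \<Rightarrow> real) \<Rightarrow> (nat \<Rightarrow> real)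
     \<Rightarrow> (nat \<Rightarrow> 'a) \<Rightarrow> bool" where
  "AdaMP f grad A \<epsilon> \<delta> \<tau> \<eta> Linit T x d gmax \<gamma> Lest s \<longleftrightarrow>
     ada_run f grad A \<epsilon> \<delta> \<tau> \<eta> Linit T x d gmax \<gamma> Lest \<and>
     (\<forall>t. enat t < T \<longrightarrow>
        s t \<in> symmetrize A \<and>
        grad (x t) \<bullet> s t \<le> \<delta> * (INF b\<in>symmetrize A. grad (x t) \<bullet> b) \<and>
        d t = s t \<and> gmax t = \<infinity>)"

end

theory Submission
  imports Defs
begin

text \<open>
  Let \<open>x\<close> be the current iterate, \<open>r\<close> the negative gradient there, \<open>d\<close> the chosen direction and
  \<open>g = r \<bullet> d\<close>. The contraction compares a lower bound for the decrease of \<open>f\<close> in terms of \<open>g\<close> with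
  an upper bound for the primal gap \<open>h\<close> in terms of \<open>g\<close>.

  \<^emph>\<open>Decrease.\<close> The step-size \<open>\<gamma>\<close> never exceeds \<open>g / (M * (norm d)\<^sup>2)\<close>, where \<open>M\<close> is the accepted
  estimate, so the sufficient decrease condition makes \<open>f\<close> drop by at least \<open>\<gamma> * g / 2\<close>
  (\<open>backtracking_progress\<close>).

  \<^emph>\<open>Primal gap.\<close> Strong convexity gives
  \<open>f x - f y \<le> r \<bullet> (y - x) - \<mu> / 2 * (norm (y - x))\<^sup>2\<close> for \<open>y\<close> in the domain. If some width \<open>W\<close> of the
  set of atoms satisfies \<open>W * (r \<bullet> (y - x)) \<le> \<Gamma> * norm (y - x)\<close> for all such \<open>y\<close>, then maximising over
  the unknown distance \<open>norm (y - x)\<close> gives \<open>W\<^sup>2 * h \<le> \<Gamma>\<^sup>2 / (2 * \<mu>)\<close>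
  (\<open>primal_gap_le_of_slope_bound\<close>). For matching pursuit \<open>W\<close> is \<open>mDW\<close> of the symmetrized atoms, and
  \<open>\<Gamma>\<close> bounds \<open>r \<bullet> z\<close> over these atoms (\<open>mDW_dominates_slope\<close>), so that \<open>\<Gamma> = g / \<delta>\<close> is possible by the
  choice of the direction. For the two Frank-Wolfe variants \<open>W\<close> is the pyramidal width and \<open>\<Gamma>\<close>
  bounds \<open>r \<bullet> (s - v)\<close> over atoms \<open>s\<close> and active atoms \<open>v\<close> (\<open>PWidth_dominates_slope\<close>). The away-step
  variant follows the better of two directions whose slopes add up to such a pairwise slope, so that
  \<open>\<Gamma> = 2 * (g / \<delta>)\<close> is possible; this is the origin of the factor 4.

  \<^emph>\<open>Combination.\<close> If \<open>\<gamma> = g / (M * (norm d)\<^sup>2)\<close>, the decrease is \<open>g\<^sup>2 / (2 * M * (norm d)\<^sup>2)\<close>; bounding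
  \<open>norm d\<close> by the diameter or the radius and \<open>g\<^sup>2\<close> from below by \<open>h\<close> gives the claim. In every other
  good step \<open>\<gamma>\<close> is a maximal step-size that is at least 1, and the decrease is at least \<open>g / 2\<close>. Here
  the linear bound \<open>h \<le> g / \<delta>\<close> gives the factor \<open>1 - \<delta> / 2\<close>, which is small enough because the width is
  at most the diameter and because an estimate that passes the decrease test along a feasible segment
  is at least \<open>\<mu>\<close> (\<open>strong_convexity_le_accepted_estimate\<close>). Both cases are in
  \<open>contraction_of_progress\<close>. That the active set represents the iterate, which the pyramidal width and
  feasibility require, is an invariant of the updates (\<open>fw_type_run_active_rep\<close>).
\<close>


section \<open>Strong convexity and the primal gap\<close>

text \<open>Convexity of \<open>f - \<mu> / 2 * (norm _)\<^sup>2\<close> along the segment from \<open>x\<close> to \<open>y\<close> bounds the difference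
  quotients of \<open>f\<close> at \<open>x\<close>; the claim is the limit of these bounds. The domain may have empty interior, which is harmless
  because \<open>f\<close> is differentiable in the whole space.\<close>

lemma strongly_convex_lower_bound:
  fixes f :: "'a::euclidean_space \<Rightarrow> real"
  assumes sc: "strongly_convex_on \<mu> D f" and der: "GDERIV f x :> g"
    and x: "x \<in> D" and y: "y \<in> D"
  shows "f x + g \<bullet> (y - x) + \<mu> / 2 * (norm (y - x))\<^sup>2 \<le> f y"
proof -
  define \<phi> where "\<phi> = (\<lambda>t. f (x + t *\<^sub>R (y - x)))"
  have "(f has_derivative (\<lambda>h. h \<bullet> g)) (at (x + 0 *\<^sub>R (y - x)))"
    using der by (simp add: gderiv_def)
  then have "(\<phi> has_derivative (\<lambda>t. (t *\<^sub>R (y - x)) \<bullet> g)) (at 0)"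
    unfolding \<phi>_def
    by (rule has_derivative_compose[rotated]) (auto intro!: derivative_eq_intros)
  then have "(\<phi> has_field_derivative g \<bullet> (y - x)) (at 0)"
    by (simp add: has_field_derivative_def inner_commute mult_commute_abs)
  then have lim: "((\<lambda>t. (\<phi> t - \<phi> 0) / t) \<longlongrightarrow> g \<bullet> (y - x)) (at_right 0)"
    by (auto simp: has_field_derivative_iff intro: tendsto_mono[OF at_le])
  have lim2: "((\<lambda>t. f y - f x - \<mu> / 2 * (1 - t) * (norm (y - x))\<^sup>2) \<longlongrightarrow>
      f y - f x - \<mu> / 2 * (1 - 0) * (norm (y - x))\<^sup>2) (at_right (0::real))"
    by (intro tendsto_intros)
  have "\<forall>\<^sub>F t in at_right 0. (\<phi> t - \<phi> 0) / t \<le> f y - f x - \<mu> / 2 * (1 - t) * (norm (y - x))\<^sup>2"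
    unfolding eventually_at_right_field
  proof (intro exI[of _ 1] conjI allI impI)
    fix t :: real assume t: "0 < t" "t < 1"
    define n where "n = (norm ((1 - t) *\<^sub>R x + t *\<^sub>R y))\<^sup>2"
    have "f ((1 - t) *\<^sub>R x + t *\<^sub>R y) - \<mu> / 2 * n
      \<le> (1 - t) * (f x - \<mu> / 2 * (norm x)\<^sup>2) + t * (f y - \<mu> / 2 * (norm y)\<^sup>2)"
      using sc x y t unfolding strongly_convex_on_def convex_on_def n_def by simp
    moreover have "n = (1 - t) * (norm x)\<^sup>2 + t * (norm y)\<^sup>2 - t * (1 - t) * (norm (y - x))\<^sup>2"
      unfolding n_def power2_norm_eq_inner
      by (simp add: algebra_simps inner_commute power2_eq_square)
    moreover have "(1 - t) *\<^sub>R x + t *\<^sub>R y = x + t *\<^sub>R (y - x)"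
      by (simp add: algebra_simps)
    ultimately have "f (x + t *\<^sub>R (y - x)) - \<mu> / 2 * ((1 - t) * (norm x)\<^sup>2 + t * (norm y)\<^sup>2
        - t * (1 - t) * (norm (y - x))\<^sup>2)
      \<le> (1 - t) * (f x - \<mu> / 2 * (norm x)\<^sup>2) + t * (f y - \<mu> / 2 * (norm y)\<^sup>2)"
      by simp
    then have "f (x + t *\<^sub>R (y - x)) - f x \<le> t * (f y - f x - \<mu> / 2 * (1 - t) * (norm (y - x))\<^sup>2)"
      by (simp only: right_diff_distrib left_diff_distrib distrib_left) (simp add: algebra_simps add_divide_distrib diff_divide_distrib)
    then have "\<phi> t - \<phi> 0 \<le> t * (f y - f x - \<mu> / 2 * (1 - t) * (norm (y - x))\<^sup>2)"
      by (simp add: \<phi>_def)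
    then show "(\<phi> t - \<phi> 0) / t \<le> f y - f x - \<mu> / 2 * (1 - t) * (norm (y - x))\<^sup>2"
      using t by (simp add: divide_le_eq mult.commute)
  qed simp
  from tendsto_le[OF _ lim2 lim this] show ?thesis by simp
qed

text \<open>For a fixed \<open>y\<close> at distance \<open>n\<close> from \<open>x\<close>, the two hypotheses bound \<open>W\<^sup>2 * (f x - f y)\<close> by
  \<open>W * \<Gamma> * n - \<mu> / 2 * W\<^sup>2 * n\<^sup>2\<close>, and the maximum of this quadratic in \<open>n\<close> does not depend on \<open>y\<close>.\<close>

lemma primal_gap_le_of_slope_bound:
  fixes f :: "'a::euclidean_space \<Rightarrow> real"
  assumes sc: "strongly_convex_on \<mu> D f" and der: "GDERIV f x :> g" and x: "x \<in> D"
    and "\<mu> > 0" "W \<ge> 0"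
    and slope: "\<And>y. y \<in> D \<Longrightarrow> W * ((- g) \<bullet> (y - x)) \<le> \<Gamma> * norm (y - x)"
  shows "W\<^sup>2 * primal_gap f D x \<le> \<Gamma>\<^sup>2 / (2 * \<mu>)"
proof (cases "W = 0")
  case True
  then show ?thesis using \<open>\<mu> > 0\<close> by simp
next
  case False
  then have W: "W > 0" using \<open>W \<ge> 0\<close> by simp
  have "f x - \<Gamma>\<^sup>2 / (2 * \<mu>) / W\<^sup>2 \<le> f y" if y: "y \<in> D" for y
  proof -
    define n where "n = norm (y - x)"
    have "W\<^sup>2 * (f x - f y) \<le> W * (W * ((- g) \<bullet> (y - x))) - \<mu> / 2 * W\<^sup>2 * n\<^sup>2"
      using mult_left_mono[OF strongly_convex_lower_bound[OF sc der x y], of "W\<^sup>2"] W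
      by (simp add: n_def algebra_simps power2_eq_square inner_diff_right)
    also have "\<dots> \<le> W * (\<Gamma> * n) - \<mu> / 2 * W\<^sup>2 * n\<^sup>2"
      using mult_left_mono[OF slope[OF y], of W] W by (simp add: n_def)
    also have "\<dots> = \<Gamma>\<^sup>2 / (2 * \<mu>) - (\<Gamma> - \<mu> * W * n)\<^sup>2 / (2 * \<mu>)"
      using \<open>\<mu> > 0\<close> by (simp add: field_simps power2_eq_square)
    also have "\<dots> \<le> \<Gamma>\<^sup>2 / (2 * \<mu>)" using \<open>\<mu> > 0\<close> by simp
    finally have "f x - f y \<le> \<Gamma>\<^sup>2 / (2 * \<mu>) / W\<^sup>2"
      using W by (subst pos_le_divide_eq) (simp_all only: mult.commute zero_less_power)
    then show ?thesis by simp
  qed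
  then have "f x - \<Gamma>\<^sup>2 / (2 * \<mu>) / W\<^sup>2 \<le> (INF y\<in>D. f y)"
    using x by (intro cINF_greatest) auto
  then have "primal_gap f D x \<le> \<Gamma>\<^sup>2 / (2 * \<mu>) / W\<^sup>2"
    by (simp add: primal_gap_def)
  then have "primal_gap f D x * W\<^sup>2 \<le> \<Gamma>\<^sup>2 / (2 * \<mu>)"
    using W by (subst (asm) pos_le_divide_eq) simp_all
  then show ?thesis by (simp only: mult.commute)
qed

text \<open>The Frank-Wolfe gap dominates the primal gap. This is the bound that serves when a step is
  truncated by its maximal step-size, where the decrease is linear in \<open>g\<close>.\<close>

lemma primal_gap_le_linear_gap:
  fixes f :: "'a::euclidean_space \<Rightarrow> real"
  assumes sc: "strongly_convex_on \<mu> D f" and der: "GDERIV f x :> g" and x: "x \<in> D"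
    and "\<mu> > 0" and gap: "\<And>y. y \<in> D \<Longrightarrow> (- g) \<bullet> (y - x) \<le> \<Gamma>"
  shows "primal_gap f D x \<le> \<Gamma>"
proof -
  have "f x - \<Gamma> \<le> f y" if "y \<in> D" for y
  proof -
    have "0 \<le> \<mu> / 2 * (norm (y - x))\<^sup>2" using \<open>\<mu> > 0\<close> by simp
    then show ?thesis
      using strongly_convex_lower_bound[OF sc der x that] gap[OF that]
      unfolding inner_minus_left by linarith
  qed
  then have "f x - \<Gamma> \<le> (INF y\<in>D. f y)"
    using x by (intro cINF_greatest) auto
  then show ?thesis by (simp add: primal_gap_def)
qed

section \<open>The pyramidal width\<close>

lemma proper_supports_nonempty:
  assumes "S \<in> proper_supports A x"
  shows "S \<noteq> {}" "S \<subseteq> A" "finite S"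
  using assms by (auto simp: proper_supports_def)

lemma proper_supports_exist:
  assumes "x \<in> convex hull A"
  shows "proper_supports A x \<noteq> {}"
proof -
  obtain S u where S: "finite S" "S \<subseteq> A" "\<forall>v\<in>S. 0 \<le> u v" "sum u S = 1" "(\<Sum>v\<in>S. u v *\<^sub>R v) = x"
    using assms unfolding convex_hull_explicit by blast
  let ?S = "{v\<in>S. u v \<noteq> 0}"
  have "sum u ?S = sum u S" "(\<Sum>v\<in>?S. u v *\<^sub>R v) = (\<Sum>v\<in>S. u v *\<^sub>R v)"
    using S(1) by (auto intro!: sum.mono_neutral_left)
  with S have "?S \<in> proper_supports A x"
    by (auto simp: proper_supports_def less_le intro!: exI[of _ u])
  then show ?thesis by blast
qed

text \<open>If \<open>v\<close> is not the only point of \<open>S\<close>, then \<open>x\<close> lies strictly between \<open>v\<close> and the weighted mean \<open>w\<close>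
  of the other points, so a face that contains \<open>x\<close> contains \<open>v\<close>. As a consequence, passing from
  \<open>A\<close> to the atoms of a face leaves the proper supports of \<open>x\<close> unchanged.\<close>

lemma proper_support_subset_face:
  assumes K: "K face_of (convex hull A)" and x: "x \<in> K" and S: "S \<in> proper_supports A x"
  shows "S \<subseteq> K"
proof
  fix v assume v: "v \<in> S"
  obtain c where fin: "finite S" and SA: "S \<subseteq> A" and c: "\<forall>v\<in>S. 0 < c v" "sum c S = (1::real)"
    "(\<Sum>v\<in>S. c v *\<^sub>R v) = x" using S by (auto simp: proper_supports_def)
  show "v \<in> K"
  proof (cases "S = {v}")
    case True
    then show ?thesis using c x by simp
  next
    case False
    define w where "w = (\<Sum>u\<in>S - {v}. (c u / (1 - c v)) *\<^sub>R u)"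
    have s: "c v + sum c (S - {v}) = 1"
      using c(2) fin v by (metis sum.remove)
    have ne: "S - {v} \<noteq> {}" using False v by auto
    have "sum c (S - {v}) > 0"
      using ne fin c(1) by (intro sum_pos) auto
    with s have cv: "c v < 1" "0 < c v" using c(1) v by auto
    have "w \<in> convex hull A"
      unfolding w_def
    proof (rule convex_sum)
      show "(\<Sum>u\<in>S - {v}. c u / (1 - c v)) = 1"
        using s cv by (simp add: sum_divide_distrib[symmetric])
    qed (use fin cv c(1) SA in \<open>auto simp: hull_inc less_imp_le\<close>)
    moreover have "x = (1 - c v) *\<^sub>R w + c v *\<^sub>R v"
    proof -
      have "(1 - c v) *\<^sub>R w = (\<Sum>u\<in>S - {v}. c u *\<^sub>R u)"
        using cv by (simp add: w_def scaleR_sum_right)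
      then show ?thesis
        using c(3) fin v by (metis sum.remove add.commute)
    qed
    moreover have "v \<in> convex hull A" using v SA by (auto intro: hull_inc)
    ultimately show ?thesis
    proof (cases "w = v")
      case True
      then have "x = v" using \<open>x = _\<close> by (simp add: scaleR_left_distrib[symmetric])
      then show ?thesis using x by simp
    next
      case False
      then have "x \<in> open_segment w v"
        using \<open>x = _\<close> cv by (auto simp: in_segment intro!: exI[of _ "c v"])
      then show ?thesis
        using K x \<open>w \<in> convex hull A\<close> \<open>v \<in> convex hull A\<close> unfolding face_of_def by blast
    qed
  qed
qed

lemma proper_support_face:
  assumes "K face_of (convex hull A)" "x \<in> K" "S \<in> proper_supports A x"
  shows "S \<in> proper_supports (K \<inter> A) x"
  using proper_support_subset_face[OF assms] assms(3) by (auto simp: proper_supports_def)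

text \<open>Infima and suprema of reals are meaningful only for nonempty sets bounded on the relevant side.
  The lemmas up to \<open>PWidth_nonneg\<close> supply this for the nested extrema in the pyramidal width.\<close>

lemma bdd_above_directional:
  fixes r :: "'a::euclidean_space"
  assumes "bounded A" "bounded S"
  shows "bdd_above ((\<lambda>(s, v). r \<bullet> (s - v)) ` (A \<times> S))"
proof -
  have "bounded ((\<lambda>z. r \<bullet> z) ` ((\<lambda>(s, v). s - v) ` (A \<times> S)))"
    using assms by (intro bounded_linear_image bounded_minus bounded_linear_inner_right)
  then show ?thesis
    by (simp add: image_image case_prod_unfold bounded_imp_bdd_above)
qed

lemma SUP_directional_nonneg:
  fixes r :: "'a::euclidean_space"
  assumes "bounded A" "S \<in> proper_supports A x"
  shows "0 \<le> (SUP (s, v)\<in>A \<times> S. r \<bullet> (s - v))"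
proof -
  obtain v where v: "v \<in> S" "v \<in> A" using proper_supports_nonempty[OF assms(2)] by auto
  have "bounded S" using proper_supports_nonempty[OF assms(2)] by (simp add: finite_imp_bounded)
  from cSUP_upper[OF _ bdd_above_directional[OF assms(1) this], of "(v, v)"] v
  show ?thesis by simp
qed

lemma PdirW_nonneg:
  fixes r :: "'a::euclidean_space"
  assumes "bounded A" "proper_supports A x \<noteq> {}"
  shows "0 \<le> PdirW A r x"
  unfolding PdirW_def using assms by (intro cINF_greatest SUP_directional_nonneg)

lemma PdirW_le:
  fixes r :: "'a::euclidean_space"
  assumes A: "bounded A" and S: "S \<in> proper_supports A x" and r: "r \<noteq> 0"
    and le: "\<And>s v. s \<in> A \<Longrightarrow> v \<in> S \<Longrightarrow> r \<bullet> (s - v) \<le> \<Gamma>"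
  shows "norm r * PdirW A r x \<le> \<Gamma>"
proof -
  have "PdirW A r x \<le> (SUP (s, v)\<in>A \<times> S. (r /\<^sub>R norm r) \<bullet> (s - v))"
    unfolding PdirW_def using S
    by (intro cINF_lower bdd_belowI2[of _ 0] SUP_directional_nonneg A)
  also have "\<dots> \<le> \<Gamma> / norm r"
    using proper_supports_nonempty[OF S] le r
    by (intro cSUP_least) (auto simp: divide_inverse mult.commute mult_left_mono)
  finally show ?thesis using r by (simp add: pos_le_divide_eq mult.commute)
qed

lemma PdirW_face_nonneg:
  fixes A :: "'a::euclidean_space set"
  assumes "bounded A" "K face_of (convex hull A)" "x \<in> K"
  shows "0 \<le> PdirW (K \<inter> A) r x"
proof -
  have "x \<in> convex hull A" using assms face_of_imp_subset by blast
  then obtain S where "S \<in> proper_supports A x" using proper_supports_exist by blast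
  then show ?thesis
    using assms by (intro PdirW_nonneg) (auto intro: proper_support_face)
qed

lemma PWidth_le_PdirW:
  fixes A :: "'a::euclidean_space set"
  assumes "bounded A" "K face_of (convex hull A)" "x \<in> K"
    "r \<in> cone hull ((\<lambda>y. y - x) ` K)" "r \<noteq> 0"
  shows "PWidth A \<le> PdirW (K \<inter> A) r x"
proof -
  let ?I = "{(K, x, r). K face_of (convex hull A) \<and> x \<in> K \<and>
                        r \<in> cone hull ((\<lambda>y. y - x) ` K) - {0}}"
  have "bdd_below ((\<lambda>(K, x, r). PdirW (K \<inter> A) r x) ` ?I)"
    using PdirW_face_nonneg[OF assms(1)] by (auto intro!: bdd_belowI2[of _ 0])
  from cINF_lower[OF this, of "(K, x, r)"] assms show ?thesis
    unfolding PWidth_def by simp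
qed

lemma PWidth_nonneg:
  fixes A :: "'a::euclidean_space set"
  assumes "bounded A" "a \<in> A" "b \<in> A" "a \<noteq> b"
  shows "0 \<le> PWidth A"
proof -
  have "b - a \<in> cone hull ((\<lambda>y. y - a) ` (convex hull A)) - {0}"
    using assms by (auto intro!: hull_inc)
  moreover have "convex hull A face_of convex hull A" "a \<in> convex hull A"
    using assms by (auto simp: face_of_refl hull_inc)
  ultimately have "{(K, x, r). K face_of (convex hull A) \<and> x \<in> K \<and>
      r \<in> cone hull ((\<lambda>y. y - x) ` K) - {0}} \<noteq> {}" (is "?I \<noteq> {}")
    by blast
  then show ?thesis
    unfolding PWidth_def using PdirW_face_nonneg[OF assms(1)]
    by (intro cINF_greatest) auto
qed

text \<open>The Moreau decomposition: \<open>r - p\<close> is orthogonal to the projection \<open>p\<close> and belongs to the polar cone.\<close>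

lemma projection_on_cone:
  fixes r :: "'a::euclidean_space"
  assumes "closed C" "convex C" "conic C" "C \<noteq> {}"
  obtains p where "p \<in> C" "(r - p) \<bullet> p = 0" "\<And>z. z \<in> C \<Longrightarrow> (r - p) \<bullet> z \<le> 0"
proof
  let ?p = "closest_point C r"
  show p: "?p \<in> C" using assms by (simp add: closest_point_in_set)
  have dot: "(r - ?p) \<bullet> (z - ?p) \<le> 0" if "z \<in> C" for z
    using closest_point_dot[OF assms(2,1) that] by simp
  have "2 *\<^sub>R ?p \<in> C" "0 *\<^sub>R ?p \<in> C" by (rule conic_mul[OF \<open>conic C\<close> p], simp)+
  from dot[OF this(1)] dot[OF this(2)] show eq: "(r - ?p) \<bullet> ?p = 0"
    by (simp add: scaleR_2)
  show "(r - ?p) \<bullet> z \<le> 0" if "z \<in> C" for z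
    using dot[OF that] eq by (simp add: inner_diff_right)
qed

text \<open>The pyramidal width only speaks about feasible directions \<open>r\<close>, whereas a negative gradient need not
  be feasible. So \<open>r\<close> is projected to a point \<open>p\<close> of the cone of feasible directions at \<open>x\<close>, which is
  closed because the convex hull is a polytope. Slopes towards points of the hull satisfy
  \<open>r \<bullet> (y - x) \<le> p \<bullet> (y - x)\<close>, so it suffices to bound \<open>norm p\<close>. Since \<open>r - p\<close> is in the polar cone, it
  supports the hull at \<open>x\<close> and cuts out a face \<open>K\<close> through \<open>x\<close>, in which \<open>p\<close> is a feasible direction. On
  \<open>K\<close> the vectors \<open>r\<close> and \<open>p\<close> have the same differences of values, and \<open>K\<close> contains the support \<open>S\<close>. Hence
  the definition of the width can be applied to \<open>K\<close> and \<open>p\<close>.\<close>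

lemma PWidth_dominates_slope:
  fixes A :: "'a::euclidean_space set"
  assumes A: "bounded A" and poly: "polytope (convex hull A)"
    and S: "S \<in> proper_supports A x" and x: "x \<in> convex hull A" and y: "y \<in> convex hull A"
    and le: "\<And>s v. s \<in> A \<Longrightarrow> v \<in> S \<Longrightarrow> r \<bullet> (s - v) \<le> \<Gamma>"
    and W: "0 \<le> PWidth A"
  shows "PWidth A * (r \<bullet> (y - x)) \<le> \<Gamma> * norm (y - x)"
proof -
  define C where "C = conic hull ((\<lambda>y. y - x) ` (convex hull A))"
  have trans: "(\<lambda>y. y - x) ` (convex hull A) = (+) (- x) ` (convex hull A)" by simp
  have "polytope ((\<lambda>y. y - x) ` (convex hull A))"
    unfolding trans using poly by (simp only: polytope_translation_eq)
  then have "closed C" unfolding C_def by (intro closed_conic_hull_strong) simp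
  moreover have "convex C"
    unfolding C_def trans by (intro convex_conic_hull convex_translation) simp
  moreover have C_step: "z - x \<in> C" if "z \<in> convex hull A" for z
    unfolding C_def using that by (auto intro: hull_inc)
  moreover have "conic C" by (simp add: C_def conic_conic_hull)
  ultimately obtain p where p: "p \<in> C" "(r - p) \<bullet> p = 0" "\<And>z. z \<in> C \<Longrightarrow> (r - p) \<bullet> z \<le> 0"
    using projection_on_cone[of C r] x by blast
  \<comment> \<open>The polar part can only decrease the slope along a feasible direction.\<close>
  have slope: "r \<bullet> (y - x) \<le> norm p * norm (y - x)"
    using p(3)[OF C_step[OF y]] norm_cauchy_schwarz[of p "y - x"]
    unfolding inner_diff_left by linarith
  obtain v where v: "v \<in> S" "v \<in> A" using proper_supports_nonempty[OF S] by auto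
  have "norm p * PWidth A \<le> \<Gamma>"
  proof (cases "p = 0")
    case True
    then show ?thesis using le[of v v] v by simp
  next
    case False
    define K where "K = convex hull A \<inter> {z. (r - p) \<bullet> z = (r - p) \<bullet> x}"
    have K: "K face_of (convex hull A)"
      unfolding K_def
    proof (rule face_of_Int_supporting_hyperplane_le)
      fix z assume "z \<in> convex hull A"
      from p(3)[OF C_step[OF this]] show "(r - p) \<bullet> z \<le> (r - p) \<bullet> x"
        by (simp only: inner_diff_right)
    qed simp
    have xK: "x \<in> K" using x by (simp add: K_def)
    obtain c z where z: "z \<in> convex hull A" "c \<ge> 0" "p = c *\<^sub>R (z - x)"
      using p(1) unfolding C_def conic_hull_explicit by blast
    \<comment> \<open>\<open>p\<close> is a positive multiple of \<open>z - x\<close> and orthogonal to \<open>r - p\<close>, so \<open>z\<close> is in the face.\<close>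
    have "(r - p) \<bullet> (z - x) = 0" using p(2) z False by auto
    then have "z \<in> K" using z(1) by (simp add: K_def inner_diff_right)
    then have pK: "p \<in> cone hull ((\<lambda>y. y - x) ` K)"
      using z(2,3) unfolding cone_hull_expl by blast
    have SK: "S \<in> proper_supports (K \<inter> A) x" by (rule proper_support_face[OF K xK S])
    have "p \<bullet> (s - u) \<le> \<Gamma>" if "s \<in> K \<inter> A" "u \<in> S" for s u
    proof -
      have "u \<in> K" using proper_supports_nonempty[OF SK] that by auto
      then have "(r - p) \<bullet> s = (r - p) \<bullet> u" using that by (simp add: K_def)
      then show ?thesis using le[of s u] that by (simp add: inner_diff_left inner_diff_right)
    qed
    then have "norm p * PdirW (K \<inter> A) p x \<le> \<Gamma>"
      using A SK False by (intro PdirW_le[of _ S]) auto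
    moreover have "norm p * PWidth A \<le> norm p * PdirW (K \<inter> A) p x"
      by (intro mult_left_mono PWidth_le_PdirW A K xK pK False) simp
    ultimately show ?thesis by simp
  qed
  then have "norm p * PWidth A * norm (y - x) \<le> \<Gamma> * norm (y - x)"
    by (intro mult_right_mono) auto
  moreover have "PWidth A * (r \<bullet> (y - x)) \<le> PWidth A * (norm p * norm (y - x))"
    using slope W by (intro mult_left_mono)
  ultimately show ?thesis by (simp add: mult_ac)
qed

text \<open>Apply \<open>PWidth_dominates_slope\<close> at an atom \<open>a\<close> with the direction towards another atom \<open>b\<close>: the slope is
  then \<open>(norm (b - a))\<^sup>2\<close>, while no pairwise slope exceeds \<open>norm (b - a) * diameter A\<close>.\<close>

lemma PWidth_le_diameter:
  fixes A :: "'a::euclidean_space set"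
  assumes A: "bounded A" and poly: "polytope (convex hull A)"
    and ab: "a \<in> A" "b \<in> A" "a \<noteq> b"
  shows "PWidth A \<le> diameter A"
proof -
  have S: "{a} \<in> proper_supports A a"
  proof -
    have "\<exists>c. (\<forall>v\<in>{a}. 0 < c v) \<and> (\<Sum>v\<in>{a}. c v) = (1::real) \<and> (\<Sum>v\<in>{a}. c v *\<^sub>R v) = a"
      by (rule exI[of _ "\<lambda>_. 1"]) simp
    then show ?thesis using ab unfolding proper_supports_def by blast
  qed
  have "(b - a) \<bullet> (s - v) \<le> norm (b - a) * diameter A" if "s \<in> A" "v \<in> {a}" for s v
  proof -
    have "norm (s - v) \<le> diameter A"
      using that ab diameter_bounded_bound[OF A, of s v] by (simp add: dist_norm)
    then show ?thesis
      using norm_cauchy_schwarz[of "b - a" "s - v"]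
      by (meson mult_left_mono norm_ge_zero order_trans)
  qed
  then have "PWidth A * ((b - a) \<bullet> (b - a)) \<le> norm (b - a) * diameter A * norm (b - a)"
    using ab by (intro PWidth_dominates_slope[OF A poly S] PWidth_nonneg[OF A ab]) (auto simp: hull_inc)
  then have "PWidth A * (norm (b - a))\<^sup>2 \<le> diameter A * (norm (b - a))\<^sup>2"
    by (simp only: power2_norm_eq_inner[symmetric] power2_eq_square mult_ac)
  then show ?thesis using ab by simp
qed

lemma norm_diff_atom_le_diameter:
  fixes A :: "'a::euclidean_space set"
  assumes "bounded A" "x \<in> convex hull A" "a \<in> A"
  shows "norm (x - a) \<le> diameter A"
proof -
  have "A \<subseteq> cball a (diameter A)"
    using diameter_bounded_bound[OF assms(1) assms(3)] by (simp add: subset_iff)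
  then have "convex hull A \<subseteq> cball a (diameter A)" by (rule hull_minimal) simp
  then have "dist a x \<le> diameter A" using assms(2) by (simp add: subset_iff)
  then show ?thesis by (simp add: dist_norm norm_minus_commute)
qed

section \<open>Radius and minimal directional width\<close>

lemma norm_le_radius:
  fixes B :: "'a::euclidean_space set"
  assumes "bounded B" "z \<in> B"
  shows "norm z \<le> radius B"
  unfolding radius_def using assms
  by (intro cSUP_upper) (auto simp: bdd_above_norm)

lemma bdd_above_normalized_inner:
  fixes B :: "'a::euclidean_space set"
  assumes "bounded B"
  shows "bdd_above ((\<lambda>z. (z \<bullet> d) / norm d) ` B)"
proof -
  have "bounded ((\<lambda>z. z \<bullet> (d /\<^sub>R norm d)) ` B)"
    by (intro bounded_linear_image assms bounded_linear_inner_left)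
  then show ?thesis by (simp add: bounded_imp_bdd_above divide_inverse mult.commute)
qed

lemma SUP_normalized_inner_nonneg:
  fixes B :: "'a::euclidean_space set"
  assumes "bounded B" "B \<noteq> {}" and sym: "\<And>z. z \<in> B \<Longrightarrow> - z \<in> B"
  shows "0 \<le> (SUP z\<in>B. (z \<bullet> d) / norm d)"
proof -
  obtain z where "z \<in> B" using assms by auto
  then show ?thesis
    using cSUP_upper[OF _ bdd_above_normalized_inner[OF assms(1)], of z d]
      cSUP_upper[OF sym bdd_above_normalized_inner[OF assms(1)], of z d] by simp
qed

text \<open>Only the orthogonal projection \<open>p\<close> of \<open>r\<close> to the span matters for inner products with elements of
  the span. If \<open>p\<close> is nonzero, it is one of the directions in the definition of \<open>mDW\<close>, and
  \<open>r \<bullet> y \<le> norm p * norm y\<close>.\<close>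

lemma mDW_dominates_slope:
  fixes B :: "'a::euclidean_space set"
  assumes B: "bounded B" "B \<noteq> {}" and sym: "\<And>z. z \<in> B \<Longrightarrow> - z \<in> B" and y: "y \<in> span B"
    and le: "\<And>z. z \<in> B \<Longrightarrow> r \<bullet> z \<le> \<Gamma>" and W: "0 \<le> mDW B"
  shows "mDW B * (r \<bullet> y) \<le> \<Gamma> * norm y"
proof -
  obtain p q where p: "p \<in> span B" and q: "\<And>w. w \<in> span B \<Longrightarrow> orthogonal q w" and r: "r = p + q"
    using orthogonal_subspace_decomp_exists[of B r] by metis
  have rw: "r \<bullet> w = p \<bullet> w" if "w \<in> span B" for w
    using q[OF that] by (simp add: r inner_add_left orthogonal_def)
  have "mDW B * norm p \<le> \<Gamma>"
  proof (cases "p = 0")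
    case True
    obtain z where "z \<in> B" using B by auto
    then show ?thesis using True le[of z] rw[OF span_base[of z B]] by simp
  next
    case False
    have "mDW B \<le> (SUP z\<in>B. (z \<bullet> p) / norm p)"
      unfolding mDW_def using p False
      by (intro cINF_lower bdd_belowI2[of _ 0] SUP_normalized_inner_nonneg B sym) auto
    also have "\<dots> \<le> \<Gamma> / norm p"
    proof (rule cSUP_least[OF B(2)])
      fix z assume "z \<in> B"
      then have "z \<bullet> p \<le> \<Gamma>" using le[of z] rw[OF span_base[of z B]] by (simp add: inner_commute)
      then show "(z \<bullet> p) / norm p \<le> \<Gamma> / norm p" by (simp add: divide_right_mono)
    qed
    finally show ?thesis using False by (simp add: pos_le_divide_eq)
  qed
  then have "mDW B * norm p * norm y \<le> \<Gamma> * norm y"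
    by (intro mult_right_mono) auto
  moreover have "mDW B * (r \<bullet> y) \<le> mDW B * (norm p * norm y)"
    using norm_cauchy_schwarz[of p y] rw[OF y] W by (intro mult_left_mono) auto
  ultimately show ?thesis by (simp add: mult_ac)
qed

lemma mDW_nonneg:
  fixes B :: "'a::euclidean_space set"
  assumes B: "bounded B" and sym: "\<And>z. z \<in> B \<Longrightarrow> - z \<in> B" and b: "b \<in> B" "b \<noteq> 0"
  shows "0 \<le> mDW B"
  unfolding mDW_def using b span_base[OF b(1)]
  by (intro cINF_greatest SUP_normalized_inner_nonneg B sym) auto

section \<open>Adaptive step-sizes\<close>

lemma backtracking_estimate_pos:
  assumes "backtracking f \<tau> \<eta> Lprev x d g gmax M \<gamma>" "\<tau> > 1" "\<eta> > 0" "Lprev > 0"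
  shows "M > 0"
proof -
  obtain M0 k where M0: "\<eta> * Lprev \<le> M0" and M: "M = \<tau> ^ k * M0"
    using assms(1) unfolding backtracking_def Bex_def atLeastAtMost_iff by blast
  have "\<eta> * Lprev > 0" using assms by simp
  then have "M0 > 0" using M0 by linarith
  then show ?thesis using assms by (simp add: M)
qed

text \<open>The accepted step-size is positive and satisfies \<open>\<gamma> * M * (norm d)\<^sup>2 \<le> g\<close>, so at most half of
  the first-order decrease \<open>\<gamma> * g\<close> is lost to the quadratic term.\<close>

lemma backtracking_progress:
  fixes x d :: "'a::euclidean_space"
  assumes bt: "backtracking f \<tau> \<eta> Lprev x d g gmax M \<gamma>"
    and pos: "\<tau> > 1" "\<eta> > 0" "Lprev > 0" and g: "g > 0" and d: "d \<noteq> 0" and gmax: "gmax > 0"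
  shows "M > 0" "\<gamma> > 0" "ereal \<gamma> \<le> gmax"
    and "\<gamma> = g / (M * (norm d)\<^sup>2) \<or> ereal \<gamma> = gmax"
    and "sufficient_decrease f x d g M \<gamma>"
    and "f (x + \<gamma> *\<^sub>R d) \<le> f x - \<gamma> * g / 2"
proof -
  have \<gamma>: "\<gamma> = trial_step d g gmax M" and sd: "sufficient_decrease f x d g M \<gamma>"
    using bt unfolding backtracking_def by auto
  show "M > 0" by (rule backtracking_estimate_pos[OF bt pos])
  define q where "q = g / (M * (norm d)\<^sup>2)"
  have q: "q > 0" using \<open>M > 0\<close> g d by (simp add: q_def)
  have min: "ereal \<gamma> = min (ereal q) gmax"
    using gmax unfolding \<gamma> trial_step_def q_def[symmetric]
    by (cases gmax) (auto simp: min_def)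
  show "ereal \<gamma> \<le> gmax" using min by simp
  show "\<gamma> = g / (M * (norm d)\<^sup>2) \<or> ereal \<gamma> = gmax"
    using min unfolding q_def[symmetric] by (auto simp: min_def split: if_splits)
  have "ereal 0 < ereal \<gamma>" unfolding min using q gmax by (simp add: zero_ereal_def[symmetric])
  then show "\<gamma> > 0" by simp
  show "sufficient_decrease f x d g M \<gamma>" by (rule sd)
  have "ereal \<gamma> \<le> ereal q" unfolding min by simp
  then have "\<gamma> * (M * (norm d)\<^sup>2) \<le> g"
    using \<open>M > 0\<close> d by (simp add: q_def pos_le_divide_eq)
  then have "\<gamma> * (\<gamma> * (M * (norm d)\<^sup>2)) \<le> \<gamma> * g" using \<open>\<gamma> > 0\<close> by simp
  then show "f (x + \<gamma> *\<^sub>R d) \<le> f x - \<gamma> * g / 2"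
    using sd unfolding sufficient_decrease_def by (simp add: power2_eq_square mult_ac)
qed

text \<open>Strong convexity bounds the value at the new point from below with curvature \<open>\<mu>\<close>, and the accepted
  decrease condition bounds it from above with curvature \<open>M\<close>.\<close>

lemma strong_convexity_le_accepted_estimate:
  fixes f :: "'a::euclidean_space \<Rightarrow> real"
  assumes sc: "strongly_convex_on \<mu> D f" and der: "GDERIV f x :> grad"
    and x: "x \<in> D" and x': "x + \<gamma> *\<^sub>R d \<in> D" and "\<gamma> > 0" "d \<noteq> 0"
    and sd: "sufficient_decrease f x d ((- grad) \<bullet> d) M \<gamma>"
  shows "\<mu> \<le> M"
proof -
  define N where "N = \<gamma>\<^sup>2 * (norm d)\<^sup>2 / 2"
  have "N > 0" using \<open>\<gamma> > 0\<close> \<open>d \<noteq> 0\<close> by (simp add: N_def)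
  have "f x + \<gamma> * (grad \<bullet> d) + \<mu> * N \<le> f (x + \<gamma> *\<^sub>R d)"
    using strongly_convex_lower_bound[OF sc der x x'] by (simp add: N_def power_mult_distrib)
  also have "\<dots> \<le> f x + \<gamma> * (grad \<bullet> d) + M * N"
    using sd by (simp add: sufficient_decrease_def N_def mult_ac)
  finally show ?thesis using \<open>N > 0\<close> by simp
qed

text \<open>Here \<open>\<Delta>\<close> stands for the diameter or the radius, \<open>n\<close> for \<open>norm d\<close>, and \<open>q\<close> for 1/4 or 1 according to
  the algorithm. The first alternative of the last hypothesis is an untruncated step. The second is a
  step truncated at some \<open>\<gamma> \<ge> 1\<close>: for \<open>\<rho> = q * \<mu> / M * (W / \<Delta>)\<^sup>2\<close> and
  the primal gap \<open>h\<close> at \<open>x\<close> it gives \<open>\<rho> \<le> 1 / 2\<close> and \<open>\<delta>\<^sup>2 * \<rho> * h \<le> \<delta> * \<rho> * g \<le> g / 2\<close>.\<close>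

lemma contraction_of_progress:
  fixes f :: "'a::euclidean_space \<Rightarrow> real"
  assumes pos: "\<mu> > 0" "M > 0" "0 < \<delta>" "\<delta> \<le> 1" "0 < g" "0 < n" "0 < q" "0 \<le> W"
    and n: "n \<le> \<Delta>"
    and dec: "f x' \<le> f x - \<gamma> * g / 2"
    and gap: "W\<^sup>2 * primal_gap f D x \<le> (g / \<delta>)\<^sup>2 / (2 * (q * \<mu>))"
    and step: "\<gamma> = g / (M * n\<^sup>2) \<or>
      1 \<le> \<gamma> \<and> primal_gap f D x \<le> g / \<delta> \<and> W \<le> \<Delta> \<and> \<mu> \<le> M \<and> q \<le> 1 / 2"
  shows "primal_gap f D x' \<le> (1 - \<delta>\<^sup>2 * (q * \<mu> / M * (W / \<Delta>)\<^sup>2)) * primal_gap f D x"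
proof -
  define \<rho> where "\<rho> = q * \<mu> / M * (W / \<Delta>)\<^sup>2"
  define h where "h = primal_gap f D x"
  have \<Delta>: "\<Delta> > 0" using n pos by simp
  have \<rho>: "\<rho> \<ge> 0" using pos by (simp add: \<rho>_def)
  have "\<delta>\<^sup>2 * \<rho> * h \<le> \<gamma> * g / 2"
    using step
  proof
    assume \<gamma>: "\<gamma> = g / (M * n\<^sup>2)"
    have "\<delta>\<^sup>2 * \<rho> * h = \<delta>\<^sup>2 * (q * \<mu>) / (M * \<Delta>\<^sup>2) * (W\<^sup>2 * h)"
      by (simp add: \<rho>_def power_divide)
    also have "\<dots> \<le> \<delta>\<^sup>2 * (q * \<mu>) / (M * \<Delta>\<^sup>2) * ((g / \<delta>)\<^sup>2 / (2 * (q * \<mu>)))"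
      using gap pos unfolding h_def by (intro mult_left_mono) auto
    also have "\<dots> = g\<^sup>2 / 2 / (M * \<Delta>\<^sup>2)"
      using pos \<Delta> by (simp add: field_simps power2_eq_square)
    also have "\<dots> \<le> g\<^sup>2 / 2 / (M * n\<^sup>2)"
      using pos n by (intro divide_left_mono mult_left_mono power_mono mult_pos_pos) auto
    also have "\<dots> = \<gamma> * g / 2"
      by (simp add: \<gamma> power2_eq_square)
    finally show ?thesis .
  next
    assume *: "1 \<le> \<gamma> \<and> primal_gap f D x \<le> g / \<delta> \<and> W \<le> \<Delta> \<and> \<mu> \<le> M \<and> q \<le> 1 / 2"
    have "q * (\<mu> / M) * (W / \<Delta>)\<^sup>2 \<le> 1 / 2 * 1 * 1"
      using * pos \<Delta> by (intro mult_mono power_le_one) auto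
    then have \<rho>2: "\<rho> \<le> 1 / 2" by (simp add: \<rho>_def)
    have "\<delta>\<^sup>2 * \<rho> * h \<le> \<delta>\<^sup>2 * \<rho> * (g / \<delta>)"
      using * \<rho> by (intro mult_left_mono) (auto simp: h_def)
    also have "\<dots> = \<delta> * \<rho> * g" using pos by (simp add: power2_eq_square)
    also have "\<dots> \<le> 1 * (1 / 2) * g"
      using pos \<rho> \<rho>2 by (intro mult_right_mono mult_mono) auto
    also have "\<dots> \<le> \<gamma> * g / 2" using * pos by simp
    finally show ?thesis .
  qed
  moreover have "primal_gap f D x' \<le> h - \<gamma> * g / 2"
    using dec by (simp add: primal_gap_def h_def)
  ultimately have "primal_gap f D x' \<le> (1 - \<delta>\<^sup>2 * \<rho>) * h"
    by (simp add: algebra_simps)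
  then show ?thesis by (simp add: \<rho>_def h_def)
qed

lemma ada_run_Lest_pos:
  assumes run: "ada_run f grad A \<epsilon> \<delta> \<tau> \<eta> Linit T x d gmax \<gamma> Lest"
    and pos: "\<tau> > 1" "\<eta> > 0" "Linit > 0"
  shows "enat t < T \<Longrightarrow> Lest t > 0"
proof (induction t)
  case 0
  have "backtracking f \<tau> \<eta> Linit (x 0) (d 0) ((- grad (x 0)) \<bullet> d 0) (gmax 0) (Lest 0) (\<gamma> 0)"
    using run 0 unfolding ada_run_def Let_def by (metis old.nat.simps(4))
  from backtracking_estimate_pos[OF this pos] show ?case .
next
  case (Suc t)
  then have "enat t < T" by (meson Suc_ile_eq order_less_imp_le)
  with Suc have L: "Lest t > 0" by simp
  have "backtracking f \<tau> \<eta> (Lest t) (x (Suc t)) (d (Suc t)) ((- grad (x (Suc t))) \<bullet> d (Suc t))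
      (gmax (Suc t)) (Lest (Suc t)) (\<gamma> (Suc t))"
    using run Suc(2) unfolding ada_run_def Let_def by (metis old.nat.simps(5))
  from backtracking_estimate_pos[OF this pos(1,2) L] show ?case .
qed

lemma ada_run_step:
  assumes run: "ada_run f grad A \<epsilon> \<delta> \<tau> \<eta> Linit T x d gmax \<gamma> Lest"
    and pos: "\<tau> > 1" "\<eta> > 0" "Linit > 0" "\<epsilon> \<ge> 0" "\<delta> > 0" and t: "enat t < T"
  obtains Lprev where "Lprev > 0" "(- grad (x t)) \<bullet> d t > 0" "d t \<noteq> 0"
    "backtracking f \<tau> \<eta> Lprev (x t) (d t) ((- grad (x t)) \<bullet> d t) (gmax t) (Lest t) (\<gamma> t)"
    "x (Suc t) = x t + \<gamma> t *\<^sub>R d t"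
proof -
  define Lprev where "Lprev = (case t of 0 \<Rightarrow> Linit | Suc n \<Rightarrow> Lest n)"
  have "Lprev > 0"
  proof (cases t)
    case (Suc n)
    then have "enat n < T" using t by (meson Suc_ile_eq order_less_imp_le)
    then show ?thesis using ada_run_Lest_pos[OF run pos(1-3)] Suc by (simp add: Lprev_def)
  qed (use pos in \<open>simp add: Lprev_def\<close>)
  moreover have *: "\<delta> * \<epsilon> < (- grad (x t)) \<bullet> d t"
    "backtracking f \<tau> \<eta> Lprev (x t) (d t) ((- grad (x t)) \<bullet> d t) (gmax t) (Lest t) (\<gamma> t)"
    "x (Suc t) = x t + \<gamma> t *\<^sub>R d t"
    using run t unfolding ada_run_def Let_def Lprev_def by blast+
  moreover have "(- grad (x t)) \<bullet> d t > 0"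
    using *(1) pos mult_nonneg_nonneg[of \<delta> \<epsilon>] by linarith
  moreover then have "d t \<noteq> 0" by auto
  ultimately show ?thesis using that by blast
qed

text \<open>Unfolds a \<open>\<delta>\<close>-approximate minimality into a bound for each competitor; the signs are those of
  slopes along the negative gradient.\<close>

lemma scaled_infimum_bound:
  fixes \<phi> :: "'b \<Rightarrow> real"
  assumes "c \<le> \<delta> * (INF a\<in>A. \<phi> a)" "0 < \<delta>" "bdd_below (\<phi> ` A)" "a \<in> A"
  shows "- \<phi> a \<le> - c / \<delta>"
proof -
  have "c \<le> \<delta> * \<phi> a"
    using assms(1) mult_left_mono[OF cINF_lower[OF assms(3,4)], of \<delta>] assms(2) by linarith
  then show ?thesis using assms(2) by (simp add: field_simps)
qed

section \<open>Matching pursuit\<close>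

lemma symmetrize_uminus: "z \<in> symmetrize A \<Longrightarrow> - z \<in> symmetrize A"
  by (auto simp: symmetrize_def)

lemma span_symmetrize: "span (symmetrize A) = span A"
proof (rule span_eq[THEN iffD2], intro conjI)
  show "symmetrize A \<subseteq> span A" by (auto simp: symmetrize_def span_base span_neg)
  show "A \<subseteq> span (symmetrize A)" by (auto simp: symmetrize_def span_base)
qed

lemma AdaMP_iterate_in_span:
  assumes "AdaMP f grad A \<epsilon> \<delta> \<tau> \<eta> Linit T x d gmax \<gamma> Lest s"
  shows "enat t \<le> T \<Longrightarrow> x t \<in> span A"
proof (induction t)
  case 0
  show ?case using assms by (simp add: AdaMP_def ada_run_def span_base)
next
  case (Suc t)
  then have t: "enat t < T" by (simp add: Suc_ile_eq)
  then have "d t \<in> symmetrize A" "x (Suc t) = x t + \<gamma> t *\<^sub>R d t"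
    using assms unfolding AdaMP_def ada_run_def Let_def by auto
  moreover then have "d t \<in> span A" using span_symmetrize span_base by blast
  ultimately show ?case using Suc t by (simp add: span_add span_scale)
qed

lemma bdd_below_inner:
  fixes A :: "'a::euclidean_space set"
  assumes "bounded A"
  shows "bdd_below ((\<lambda>a. r \<bullet> a) ` A)"
  by (intro bounded_imp_bdd_below bounded_linear_image assms bounded_linear_inner_right)

text \<open>All steps are untruncated, because the maximal step-size is infinite.\<close>

lemma AdaMP_contraction:
  fixes A :: "'a::euclidean_space set"
  assumes A: "A \<noteq> {}" "bounded A" "A \<noteq> {0}"
    and der: "\<And>y. GDERIV f y :> grad y"
    and pos: "\<mu> > 0" "\<epsilon> \<ge> 0" "0 < \<delta>" "\<delta> \<le> 1" "\<tau> > 1" "0 < \<eta>" "Linit > 0"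
    and sc: "strongly_convex_on \<mu> (span A) f"
    and mp: "AdaMP f grad A \<epsilon> \<delta> \<tau> \<eta> Linit T x d gmax \<gamma> Lest s"
    and t: "enat t < T"
  shows "primal_gap f (span A) (x (Suc t))
    \<le> (1 - \<delta>\<^sup>2 * (\<mu> / Lest t * (mDW (symmetrize A) / radius (symmetrize A))\<^sup>2))
       * primal_gap f (span A) (x t)"
proof -
  let ?B = "symmetrize A" and ?g = "(- grad (x t)) \<bullet> d t"
  have run: "ada_run f grad A \<epsilon> \<delta> \<tau> \<eta> Linit T x d gmax \<gamma> Lest"
    using mp by (simp add: AdaMP_def)
  from mp t have dB: "d t \<in> ?B" and gm: "gmax t = \<infinity>"
    and dmin: "grad (x t) \<bullet> d t \<le> \<delta> * (INF b\<in>?B. grad (x t) \<bullet> b)"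
    by (auto simp: AdaMP_def)
  obtain Lprev where st: "Lprev > 0" "?g > 0" "d t \<noteq> 0"
    "backtracking f \<tau> \<eta> Lprev (x t) (d t) ?g (gmax t) (Lest t) (\<gamma> t)"
    "x (Suc t) = x t + \<gamma> t *\<^sub>R d t"
    using ada_run_step[OF run pos(5-7) pos(2,3) t] by blast
  have "gmax t > 0" by (simp add: gm)
  note bt = backtracking_progress[OF st(4) pos(5,6) st(1-3) this]
  have B: "bounded ?B" "?B \<noteq> {}" using A by (auto simp: symmetrize_def bounded_uminus)
  have W: "0 \<le> mDW ?B" by (rule mDW_nonneg[OF B(1) symmetrize_uminus dB st(3)])
  have xs: "x t \<in> span A" using AdaMP_iterate_in_span[OF mp] t by (simp add: order_less_imp_le)
  have le: "(- grad (x t)) \<bullet> z \<le> ?g / \<delta>" if "z \<in> ?B" for z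
    using scaled_infimum_bound[OF dmin pos(3) bdd_below_inner[OF B(1)] that] by simp
  have "(mDW ?B)\<^sup>2 * primal_gap f (span A) (x t) \<le> (?g / \<delta>)\<^sup>2 / (2 * \<mu>)"
  proof (rule primal_gap_le_of_slope_bound[OF sc der xs pos(1) W])
    fix y assume "y \<in> span A"
    then have "y - x t \<in> span ?B" using xs by (simp add: span_symmetrize span_diff)
    from mDW_dominates_slope[OF B symmetrize_uminus this le W]
    show "mDW ?B * ((- grad (x t)) \<bullet> (y - x t)) \<le> ?g / \<delta> * norm (y - x t)" .
  qed
  then have gap: "(mDW ?B)\<^sup>2 * primal_gap f (span A) (x t) \<le> (?g / \<delta>)\<^sup>2 / (2 * (1 * \<mu>))" by simp
  have \<gamma>: "\<gamma> t = ?g / (Lest t * (norm (d t))\<^sup>2)" using bt(4) gm by auto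
  have n: "norm (d t) > 0" using st(3) by simp
  have "primal_gap f (span A) (x t + \<gamma> t *\<^sub>R d t)
    \<le> (1 - \<delta>\<^sup>2 * (1 * \<mu> / Lest t * (mDW ?B / radius ?B)\<^sup>2)) * primal_gap f (span A) (x t)"
    by (rule contraction_of_progress[where x = "x t", OF pos(1) bt(1) pos(3,4) st(2) n zero_less_one W
          norm_le_radius[OF B(1) dB] bt(6) gap disjI1[OF \<gamma>]])
  then show ?thesis by (simp add: st(5))
qed

section \<open>Active sets\<close>

text \<open>The invariant of the weight updates. Requiring \<open>S\<close> to be exactly the set where \<open>\<alpha>\<close> is nonzero,
  together with nonnegativity of \<open>\<alpha>\<close> everywhere, allows the atom that enters or leaves to be treated
  without a case distinction on membership.\<close>

definition active_rep :: "'a::euclidean_space set \<Rightarrow> 'a \<Rightarrow> 'a set \<Rightarrow> ('a \<Rightarrow> real) \<Rightarrow> bool" where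
  "active_rep A x S \<alpha> \<longleftrightarrow>
     finite S \<and> S \<subseteq> A \<and> S = {u. \<alpha> u \<noteq> 0} \<and> (\<forall>u. 0 \<le> \<alpha> u) \<and>
     (\<Sum>u\<in>S. \<alpha> u) = 1 \<and> (\<Sum>u\<in>S. \<alpha> u *\<^sub>R u) = x"

lemma active_rep_pos: "active_rep A x S \<alpha> \<Longrightarrow> u \<in> S \<Longrightarrow> 0 < \<alpha> u"
  by (auto simp: active_rep_def less_le)

lemma active_rep_proper_support: "active_rep A x S \<alpha> \<Longrightarrow> S \<in> proper_supports A x"
  unfolding proper_supports_def using active_rep_pos[of A x S \<alpha>]
  by (auto simp: active_rep_def)

lemma active_rep_in_convex_hull: 
  assumes "active_rep A x S \<alpha>"
  shows "x \<in> convex hull A"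
proof -
  have "(\<Sum>u\<in>S. \<alpha> u *\<^sub>R u) \<in> convex hull A"
    using assms by (intro convex_sum) (auto simp: active_rep_def hull_inc)
  moreover have "(\<Sum>u\<in>S. \<alpha> u *\<^sub>R u) = x" using assms unfolding active_rep_def by blast
  ultimately show ?thesis by simp
qed

text \<open>Excludes the degenerate away step from a single active atom, for which \<open>\<alpha> v / (1 - \<alpha> v)\<close> would be a
  division by zero: there the direction \<open>x - v\<close> vanishes.\<close>

lemma active_rep_full_weight:
  assumes rep: "active_rep A x S \<alpha>" and v: "v \<in> S"
  shows "\<alpha> v \<le> 1" "\<alpha> v = 1 \<Longrightarrow> x = v"
proof -
  have fin: "finite S" and nn: "\<And>u. 0 \<le> \<alpha> u" and supp: "S = {u. \<alpha> u \<noteq> 0}"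
    and x: "(\<Sum>u\<in>S. \<alpha> u *\<^sub>R u) = x" and s1: "(\<Sum>u\<in>S. \<alpha> u) = 1"
    using rep by (auto simp: active_rep_def)
  have s: "\<alpha> v + sum \<alpha> (S - {v}) = 1" using s1 fin v by (simp add: sum.remove[of S v])
  show "\<alpha> v \<le> 1" using s sum_nonneg[of "S - {v}" \<alpha>] nn by simp
  assume 1: "\<alpha> v = 1"
  then have "sum \<alpha> (S - {v}) = 0" using s by simp
  then have "\<forall>u\<in>S - {v}. \<alpha> u = 0"
    using fin nn by (subst (asm) sum_nonneg_eq_0_iff) auto
  then have "S = {v}" using v supp by blast
  then show "x = v" using x 1 by simp
qed

text \<open>The \<open>\<alpha>\<close>-weighted mean of the slopes \<open>r \<bullet> (u - x)\<close> vanishes, so their upper bounds are nonnegative.\<close>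

lemma active_rep_mean:
  assumes rep: "active_rep A x S \<alpha>" and le: "\<And>u. u \<in> S \<Longrightarrow> r \<bullet> (u - x) \<le> c"
  shows "0 \<le> c"
proof -
  have x: "(\<Sum>u\<in>S. \<alpha> u *\<^sub>R u) = x" and s1: "(\<Sum>u\<in>S. \<alpha> u) = 1"
    using rep by (auto simp: active_rep_def)
  have "(\<Sum>u\<in>S. \<alpha> u *\<^sub>R (u - x)) = 0"
    by (simp add: scaleR_diff_right sum_subtractf x scaleR_sum_left[symmetric] s1)
  then have "r \<bullet> (\<Sum>u\<in>S. \<alpha> u *\<^sub>R (u - x)) = 0" by simp
  then have "0 = (\<Sum>u\<in>S. \<alpha> u * (r \<bullet> (u - x)))" by (simp add: inner_sum_right)
  also have "\<dots> \<le> (\<Sum>u\<in>S. \<alpha> u * c)"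
    using rep le by (intro sum_mono mult_left_mono) (auto simp: active_rep_def)
  also have "\<dots> = c" by (simp add: sum_distrib_right[symmetric] s1)
  finally show ?thesis .
qed

text \<open>Frank-Wolfe, away and pairwise steps all rescale the weights by a factor \<open>a\<close> and shift the weights
  of at most two atoms, with coefficients that sum to 1. The points \<open>s\<close> and \<open>v\<close> may coincide, which
  covers the steps that involve one atom only.\<close>

lemma active_rep_update:
  assumes rep: "active_rep A x S \<alpha>" and s: "s \<in> A" and v: "v \<in> insert s S"
    and \<alpha>': "\<And>u. \<alpha>' u = a * \<alpha> u + (if u = s then b else 0) + (if u = v then c else 0)"
    and abc: "a + b + c = 1" and nn: "\<And>u. 0 \<le> \<alpha>' u" and S': "S' = {u. \<alpha>' u \<noteq> 0}"
    and x': "x' = a *\<^sub>R x + b *\<^sub>R s + c *\<^sub>R v"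
  shows "active_rep A x' S' \<alpha>'"
proof -
  let ?U = "insert s S"
  have fin: "finite ?U" and SA: "?U \<subseteq> A" and supp: "S = {u. \<alpha> u \<noteq> 0}"
    and x: "(\<Sum>u\<in>S. \<alpha> u *\<^sub>R u) = x" and s1: "(\<Sum>u\<in>S. \<alpha> u) = 1"
    using rep s by (auto simp: active_rep_def)
  have S'U: "S' \<subseteq> ?U" using v by (auto simp: S' \<alpha>' supp split: if_splits)
  \<comment> \<open>All sums are taken over the common index set \<open>insert s S\<close>.\<close>
  have U: "(\<Sum>u\<in>?U. \<alpha> u) = 1" "(\<Sum>u\<in>?U. \<alpha> u *\<^sub>R u) = x"
    unfolding s1[symmetric] x[symmetric]
    by (rule sum.mono_neutral_right[OF fin]; use supp in auto)+
  have "(\<Sum>u\<in>S'. \<alpha>' u) = (\<Sum>u\<in>?U. \<alpha>' u)"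
    by (rule sum.mono_neutral_left[OF fin S'U]) (simp add: S')
  also have "\<dots> = a * (\<Sum>u\<in>?U. \<alpha> u) + b + c"
    using fin v by (simp add: \<alpha>' sum.distrib sum_distrib_left del: sum.insert_if sum.insert)
  finally have sum1: "(\<Sum>u\<in>S'. \<alpha>' u) = 1" by (simp add: U abc)
  have "(\<Sum>u\<in>S'. \<alpha>' u *\<^sub>R u) = (\<Sum>u\<in>?U. \<alpha>' u *\<^sub>R u)"
    by (rule sum.mono_neutral_left[OF fin S'U]) (simp add: S')
  also have "\<dots> = (\<Sum>u\<in>?U. a *\<^sub>R (\<alpha> u *\<^sub>R u) + (if u = s then b *\<^sub>R s else 0)
      + (if u = v then c *\<^sub>R v else 0))"
    by (intro sum.cong) (auto simp: \<alpha>' scaleR_left_distrib)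
  also have "\<dots> = a *\<^sub>R (\<Sum>u\<in>?U. \<alpha> u *\<^sub>R u) + b *\<^sub>R s + c *\<^sub>R v"
    using fin v by (simp add: sum.distrib scaleR_sum_right del: sum.insert_if sum.insert)
  finally have "(\<Sum>u\<in>S'. \<alpha>' u *\<^sub>R u) = x'" by (simp add: U x')
  with sum1 show ?thesis
    unfolding active_rep_def using S'U SA fin nn S' by (auto intro: finite_subset)
qed

lemma fw_step_active_rep:
  assumes rep: "active_rep A x S \<alpha>" and s: "s \<in> A" and st: "fw_step x s S \<alpha> d gmax \<gamma> S' \<alpha>'"
    and \<gamma>: "0 < \<gamma>" "ereal \<gamma> \<le> gmax"
  shows "active_rep A (x + \<gamma> *\<^sub>R d) S' \<alpha>'"
proof -
  have d: "d = s - x" and \<gamma>1: "\<gamma> \<le> 1" and S': "S' = (if \<gamma> = 1 then {s} else S \<union> {s})"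
    and \<alpha>': "\<alpha>' = (\<lambda>u. if u = s then (1 - \<gamma>) * \<alpha> u + \<gamma> else (1 - \<gamma>) * \<alpha> u)"
    using st \<gamma>(2) by (auto simp: fw_step_def one_ereal_def)
  have nn: "\<And>u. 0 \<le> \<alpha> u" and supp: "S = {u. \<alpha> u \<noteq> 0}" using rep by (auto simp: active_rep_def)
  have nn': "0 \<le> (1 - \<gamma>) * \<alpha> u" for u using nn \<gamma>1 by simp
  have "(1 - \<gamma>) * \<alpha> s + \<gamma> > 0" using nn'[of s] \<gamma> by linarith
  then show ?thesis
    using nn' \<gamma> \<gamma>1
    by (intro active_rep_update[OF rep s, of s \<alpha>' "1 - \<gamma>" \<gamma> 0])
       (auto simp: \<alpha>' S' d supp algebra_simps)
qed

lemma away_step_active_rep: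
  assumes rep: "active_rep A x S \<alpha>" and v: "v \<in> S" and st: "away_step x v S \<alpha> d gmax \<gamma> S' \<alpha>'"
    and d0: "d \<noteq> 0"
  shows "0 < gmax"
    and "0 < \<gamma> \<Longrightarrow> ereal \<gamma> \<le> gmax \<Longrightarrow> active_rep A (x + \<gamma> *\<^sub>R d) S' \<alpha>'"
proof -
  have d: "d = x - v" and gm: "gmax = ereal (\<alpha> v / (1 - \<alpha> v))"
    and S': "S' = (if ereal \<gamma> = gmax then S - {v} else S)"
    and \<alpha>': "\<alpha>' = (\<lambda>u. if u = v then (1 + \<gamma>) * \<alpha> u - \<gamma> else (1 + \<gamma>) * \<alpha> u)"
    using st by (auto simp: away_step_def)
  have nn: "\<And>u. 0 \<le> \<alpha> u" and supp: "S = {u. \<alpha> u \<noteq> 0}" and vA: "v \<in> A"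
    using rep v by (auto simp: active_rep_def)
  have "\<alpha> v \<noteq> 1" using active_rep_full_weight(2)[OF rep v] d d0 by auto
  then have av: "\<alpha> v < 1" using active_rep_full_weight(1)[OF rep v] by simp
  have av0: "\<alpha> v > 0" by (rule active_rep_pos[OF rep v])
  show "0 < gmax" using av av0 by (simp add: gm)
  assume \<gamma>: "0 < \<gamma>" "ereal \<gamma> \<le> gmax"
  then have le: "\<gamma> * (1 - \<alpha> v) \<le> \<alpha> v" using av by (simp add: gm pos_le_divide_eq)
  \<comment> \<open>The maximal away step is the one at which the weight of \<open>v\<close> becomes zero.\<close>
  have eq: "ereal \<gamma> = gmax \<longleftrightarrow> (1 + \<gamma>) * \<alpha> v - \<gamma> = 0"
    using av by (auto simp: gm field_simps)
  have nn': "0 \<le> (1 + \<gamma>) * \<alpha> u" for u using nn \<gamma> by simp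
  have "0 \<le> (1 + \<gamma>) * \<alpha> v - \<gamma>" using le by (simp add: algebra_simps)
  then have nn2: "0 \<le> \<alpha>' u" for u using nn' by (simp add: \<alpha>')
  show "active_rep A (x + \<gamma> *\<^sub>R d) S' \<alpha>'"
  proof (rule active_rep_update[OF rep vA, of v \<alpha>' "1 + \<gamma>" 0 "- \<gamma>"])
    show "S' = {u. \<alpha>' u \<noteq> 0}"
      using \<gamma> v unfolding S' eq by (auto simp: \<alpha>' supp)
  qed (use nn2 in \<open>auto simp: \<alpha>' d algebra_simps\<close>)
qed

lemma pairwise_step_active_rep:
  assumes rep: "active_rep A x S \<alpha>" and s: "s \<in> A" and v: "v \<in> S"
    and st: "pairwise_step s v S \<alpha> d gmax \<gamma> S' \<alpha>'" and d0: "d \<noteq> 0"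
  shows "0 < gmax"
    and "0 < \<gamma> \<Longrightarrow> ereal \<gamma> \<le> gmax \<Longrightarrow> active_rep A (x + \<gamma> *\<^sub>R d) S' \<alpha>'"
proof -
  have d: "d = s - v" and gm: "gmax = ereal (\<alpha> v)"
    and \<alpha>': "\<alpha>' = \<alpha>(s := \<alpha> s + \<gamma>, v := \<alpha> v - \<gamma>)"
    and S': "S' = (if \<alpha>' v = 0 then (S - {v}) \<union> {s} else S \<union> {s})"
    using st by (auto simp: pairwise_step_def)
  have sv: "s \<noteq> v" using d d0 by auto
  have nn: "\<And>u. 0 \<le> \<alpha> u" and supp: "S = {u. \<alpha> u \<noteq> 0}"
    using rep by (auto simp: active_rep_def)
  show "0 < gmax" using active_rep_pos[OF rep v] by (simp add: gm)
  assume \<gamma>: "0 < \<gamma>" "ereal \<gamma> \<le> gmax"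
  have "\<alpha> s + \<gamma> > 0" using nn[of s] \<gamma> by linarith
  then have nn2: "0 \<le> \<alpha>' u" and pos: "\<alpha>' s > 0" for u using nn \<gamma> sv by (auto simp: \<alpha>' gm)
  show "active_rep A (x + \<gamma> *\<^sub>R d) S' \<alpha>'"
  proof (rule active_rep_update[OF rep s, of v \<alpha>' 1 \<gamma> "- \<gamma>"])
    show "S' = {u. \<alpha>' u \<noteq> 0}"
      using pos sv v unfolding S' by (auto simp: \<alpha>' supp)
  qed (use nn2 sv v in \<open>auto simp: \<alpha>' d algebra_simps\<close>)
qed

section \<open>Away-step and pairwise Frank-Wolfe\<close>

lemma fw_atom_bound:
  fixes A :: "'a::euclidean_space set"
  assumes "fw_atom grad A \<delta> x s" "0 < \<delta>" "bounded A" "a \<in> A"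
  shows "(- grad x) \<bullet> (a - x) \<le> (- grad x) \<bullet> (s - x) / \<delta>"
proof -
  have "bounded ((\<lambda>a. grad x \<bullet> a) ` (\<lambda>a. a - x) ` A)"
    by (rule bounded_linear_image[OF bounded_translation_minus[OF assms(3)] bounded_linear_inner_right])
  then have "bdd_below ((\<lambda>a. grad x \<bullet> (a - x)) ` A)"
    by (simp add: image_image bounded_imp_bdd_below)
  from scaled_infimum_bound[OF _ assms(2) this assms(4)] assms(1) show ?thesis
    by (simp add: fw_atom_def)
qed

lemma away_atom_bound:
  assumes "away_atom grad S \<delta> x v" "0 < \<delta>" "finite S" "u \<in> S"
  shows "(- grad x) \<bullet> (x - u) \<le> (- grad x) \<bullet> (x - v) / \<delta>"
proof -
  have "bdd_below ((\<lambda>u. grad x \<bullet> (x - u)) ` S)" using assms(3) by simp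
  from scaled_infimum_bound[OF _ assms(2) this assms(4)] assms(1) show ?thesis
    by (simp add: away_atom_def)
qed

text \<open>What the contraction argument needs to know about a direction, common to both variants. The last
  conjunct is the pairwise slope bound; its factor 2 stems from the away-step variant, which follows
  only one of the two directions whose slopes make up a pairwise slope.\<close>

definition fw_type_iteration where
  "fw_type_iteration grad A \<delta> x d gmax S \<longleftrightarrow>
     0 < gmax \<and> norm d \<le> diameter A \<and>
     (\<forall>a\<in>A. (- grad x) \<bullet> (a - x) \<le> (- grad x) \<bullet> d / \<delta>) \<and>
     (\<forall>a\<in>A. \<forall>u\<in>S. (- grad x) \<bullet> (a - u) \<le> 2 * ((- grad x) \<bullet> d / \<delta>))"

lemma AdaAFW_iteration:
  fixes A :: "'a::euclidean_space set"
  assumes afw: "AdaAFW f grad A \<epsilon> \<delta> \<tau> \<eta> Linit T x d gmax \<gamma> Lest s v S \<alpha>"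
    and A: "bounded A" and \<delta>: "0 < \<delta>" and t: "enat t < T" and d0: "d t \<noteq> 0"
    and rep: "active_rep A (x t) (S t) (\<alpha> t)"
  shows "fw_type_iteration grad A \<delta> (x t) (d t) (gmax t) (S t)"
    and "0 < \<gamma> t \<Longrightarrow> ereal (\<gamma> t) \<le> gmax t \<Longrightarrow>
      active_rep A (x t + \<gamma> t *\<^sub>R d t) (S (Suc t)) (\<alpha> (Suc t))"
proof -
  let ?r = "- grad (x t)"
  have fin: "finite (S t)" and SA: "S t \<subseteq> A" using rep by (auto simp: active_rep_def)
  have fw: "fw_atom grad A \<delta> (x t) (s t)" and aw: "away_atom grad (S t) \<delta> (x t) (v t)"
    and st: "if grad (x t) \<bullet> (s t - x t) \<le> grad (x t) \<bullet> (x t - v t)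
         then fw_step (x t) (s t) (S t) (\<alpha> t) (d t) (gmax t) (\<gamma> t) (S (Suc t)) (\<alpha> (Suc t))
         else away_step (x t) (v t) (S t) (\<alpha> t) (d t) (gmax t) (\<gamma> t) (S (Suc t)) (\<alpha> (Suc t))"
    using afw t by (simp_all add: AdaAFW_def)
  have s: "s t \<in> A" and v: "v t \<in> S t" using fw aw by (auto simp: fw_atom_def away_atom_def)
  \<comment> \<open>The chosen direction has the larger of the two slopes.\<close>
  have "?r \<bullet> (s t - x t) \<le> ?r \<bullet> d t" "?r \<bullet> (x t - v t) \<le> ?r \<bullet> d t"
    using st by (auto simp: fw_step_def away_step_def split: if_splits)
  then have g: "?r \<bullet> (s t - x t) / \<delta> \<le> ?r \<bullet> d t / \<delta>" "?r \<bullet> (x t - v t) / \<delta> \<le> ?r \<bullet> d t / \<delta>"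
    using \<delta> by (simp_all add: divide_right_mono)
  have a: "?r \<bullet> (a - x t) \<le> ?r \<bullet> d t / \<delta>" if "a \<in> A" for a
    using fw_atom_bound[OF fw \<delta> A that] g(1) by linarith
  have u: "?r \<bullet> (x t - u) \<le> ?r \<bullet> d t / \<delta>" if "u \<in> S t" for u
    using away_atom_bound[OF aw \<delta> fin that] g(2) by linarith
  have au: "?r \<bullet> (a' - u') \<le> 2 * (?r \<bullet> d t / \<delta>)" if "a' \<in> A" "u' \<in> S t" for a' u'
    using a[OF that(1)] u[OF that(2)] unfolding inner_diff_right by linarith
  have xc: "x t \<in> convex hull A" by (rule active_rep_in_convex_hull[OF rep])
  have "norm (d t) \<le> diameter A"
    using st norm_diff_atom_le_diameter[OF A xc s] norm_diff_atom_le_diameter[OF A xc] v SA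
    by (auto simp: fw_step_def away_step_def norm_minus_commute split: if_splits)
  moreover have "0 < gmax t"
    using st away_step_active_rep(1)[OF rep v _ d0] by (auto simp: fw_step_def split: if_splits)
  ultimately show "fw_type_iteration grad A \<delta> (x t) (d t) (gmax t) (S t)"
    using a au by (simp add: fw_type_iteration_def)
  show "active_rep A (x t + \<gamma> t *\<^sub>R d t) (S (Suc t)) (\<alpha> (Suc t))"
    if "0 < \<gamma> t" "ereal (\<gamma> t) \<le> gmax t"
    using st fw_step_active_rep[OF rep s _ that] away_step_active_rep(2)[OF rep v _ d0 that]
    by (auto split: if_splits)
qed

lemma AdaPFW_iteration:
  fixes A :: "'a::euclidean_space set"
  assumes pfw: "AdaPFW f grad A \<epsilon> \<delta> \<tau> \<eta> Linit T x d gmax \<gamma> Lest s v S \<alpha>"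
    and A: "bounded A" and \<delta>: "0 < \<delta>" and t: "enat t < T" and d0: "d t \<noteq> 0"
    and rep: "active_rep A (x t) (S t) (\<alpha> t)"
  shows "fw_type_iteration grad A \<delta> (x t) (d t) (gmax t) (S t)"
    and "0 < \<gamma> t \<Longrightarrow> ereal (\<gamma> t) \<le> gmax t \<Longrightarrow>
      active_rep A (x t + \<gamma> t *\<^sub>R d t) (S (Suc t)) (\<alpha> (Suc t))"
proof -
  let ?r = "- grad (x t)"
  have fin: "finite (S t)" and SA: "S t \<subseteq> A" using rep by (auto simp: active_rep_def)
  have fw: "fw_atom grad A \<delta> (x t) (s t)" and aw: "away_atom grad (S t) \<delta> (x t) (v t)"
    and st: "pairwise_step (s t) (v t) (S t) (\<alpha> t) (d t) (gmax t) (\<gamma> t) (S (Suc t)) (\<alpha> (Suc t))"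
    using pfw t by (simp_all add: AdaPFW_def)
  have d: "d t = s t - v t" using st by (simp add: pairwise_step_def)
  have s: "s t \<in> A" and v: "v t \<in> S t" using fw aw by (auto simp: fw_atom_def away_atom_def)
  \<comment> \<open>The pairwise slope is the sum of the Frank-Wolfe and the away slope; the mean slope
    over the active set is zero, so both are nonnegative and hence bounded by their sum.\<close>
  have "0 \<le> ?r \<bullet> (s t - x t) / \<delta>"
    using active_rep_mean[OF rep] fw_atom_bound[OF fw \<delta> A] SA by blast
  moreover have "0 \<le> ?r \<bullet> (x t - v t) / \<delta>"
  proof (rule active_rep_mean[OF rep])
    show "grad (x t) \<bullet> (u - x t) \<le> ?r \<bullet> (x t - v t) / \<delta>" if "u \<in> S t" for u
      using away_atom_bound[OF aw \<delta> fin that] by (simp add: inner_diff_right)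
  qed
  moreover have "?r \<bullet> d t / \<delta> = ?r \<bullet> (s t - x t) / \<delta> + ?r \<bullet> (x t - v t) / \<delta>"
    by (simp add: d inner_diff_right add_divide_distrib[symmetric])
  ultimately have g: "?r \<bullet> (s t - x t) / \<delta> \<le> ?r \<bullet> d t / \<delta>" "?r \<bullet> (x t - v t) / \<delta> \<le> ?r \<bullet> d t / \<delta>"
    by linarith+
  have a: "?r \<bullet> (a - x t) \<le> ?r \<bullet> d t / \<delta>" if "a \<in> A" for a
    using fw_atom_bound[OF fw \<delta> A that] g(1) by linarith
  have u: "?r \<bullet> (x t - u) \<le> ?r \<bullet> d t / \<delta>" if "u \<in> S t" for u
    using away_atom_bound[OF aw \<delta> fin that] g(2) by linarith
  have au: "?r \<bullet> (a' - u') \<le> 2 * (?r \<bullet> d t / \<delta>)" if "a' \<in> A" "u' \<in> S t" for a' u'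
    using a[OF that(1)] u[OF that(2)] unfolding inner_diff_right by linarith
  have "norm (d t) \<le> diameter A"
    using diameter_bounded_bound[OF A s, of "v t"] v SA by (auto simp: d dist_norm)
  with pairwise_step_active_rep(1)[OF rep s v st d0] a au
  show "fw_type_iteration grad A \<delta> (x t) (d t) (gmax t) (S t)"
    by (simp add: fw_type_iteration_def)
  show "active_rep A (x t + \<gamma> t *\<^sub>R d t) (S (Suc t)) (\<alpha> (Suc t))"
    if "0 < \<gamma> t" "ereal (\<gamma> t) \<le> gmax t"
    by (rule pairwise_step_active_rep(2)[OF rep s v st d0 that])
qed

lemma AdaAFW_or_AdaPFW_iteration:
  fixes A :: "'a::euclidean_space set"
  assumes alg: "AdaAFW f grad A \<epsilon> \<delta> \<tau> \<eta> Linit T x d gmax \<gamma> Lest s v S \<alpha> \<or>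
       AdaPFW f grad A \<epsilon> \<delta> \<tau> \<eta> Linit T x d gmax \<gamma> Lest s v S \<alpha>"
    and hyps: "bounded A" "0 < \<delta>" "enat t < T" "d t \<noteq> 0" "active_rep A (x t) (S t) (\<alpha> t)"
  shows "fw_type_iteration grad A \<delta> (x t) (d t) (gmax t) (S t)"
    and "0 < \<gamma> t \<Longrightarrow> ereal (\<gamma> t) \<le> gmax t \<Longrightarrow>
      active_rep A (x t + \<gamma> t *\<^sub>R d t) (S (Suc t)) (\<alpha> (Suc t))"
proof -
  show "fw_type_iteration grad A \<delta> (x t) (d t) (gmax t) (S t)"
    using alg by (elim disjE) (rule AdaAFW_iteration(1) AdaPFW_iteration(1); (rule hyps | assumption))+
  show "active_rep A (x t + \<gamma> t *\<^sub>R d t) (S (Suc t)) (\<alpha> (Suc t))"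
    if "0 < \<gamma> t" "ereal (\<gamma> t) \<le> gmax t"
    using alg by (elim disjE) (rule AdaAFW_iteration(2) AdaPFW_iteration(2); (rule hyps that | assumption))+
qed

text \<open>The step-size of iteration \<open>t\<close> is in the range where the weights stay nonnegative because the maximal
  step-size is positive, and this in turn depends on the invariant at \<open>t\<close>.\<close>

lemma fw_type_run_active_rep:
  fixes A :: "'a::euclidean_space set"
  assumes alg: "AdaAFW f grad A \<epsilon> \<delta> \<tau> \<eta> Linit T x d gmax \<gamma> Lest s v S \<alpha> \<or>
       AdaPFW f grad A \<epsilon> \<delta> \<tau> \<eta> Linit T x d gmax \<gamma> Lest s v S \<alpha>"
    and A: "bounded A" and pos: "\<tau> > 1" "\<eta> > 0" "Linit > 0" "\<epsilon> \<ge> 0" "\<delta> > 0"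
  shows "enat t \<le> T \<Longrightarrow> active_rep A (x t) (S t) (\<alpha> t)"
proof (induction t)
  case 0
  have "S 0 = {x 0}" "\<alpha> 0 = (\<lambda>u. if u = x 0 then 1 else 0)" "x 0 \<in> A"
    using alg by (auto simp: AdaAFW_def AdaPFW_def active_init_def ada_run_def)
  then show ?case by (simp add: active_rep_def)
next
  case (Suc t)
  then have t: "enat t < T" by (simp add: Suc_ile_eq)
  then have rep: "active_rep A (x t) (S t) (\<alpha> t)" using Suc by simp
  have run: "ada_run f grad A \<epsilon> \<delta> \<tau> \<eta> Linit T x d gmax \<gamma> Lest"
    using alg by (auto simp: AdaAFW_def AdaPFW_def)
  obtain Lprev where st: "Lprev > 0" "(- grad (x t)) \<bullet> d t > 0" "d t \<noteq> 0"
    "backtracking f \<tau> \<eta> Lprev (x t) (d t) ((- grad (x t)) \<bullet> d t) (gmax t) (Lest t) (\<gamma> t)"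
    "x (Suc t) = x t + \<gamma> t *\<^sub>R d t"
    using ada_run_step[OF run pos t] by blast
  have "fw_type_iteration grad A \<delta> (x t) (d t) (gmax t) (S t)"
    by (rule AdaAFW_or_AdaPFW_iteration(1)[OF alg A pos(5) t st(3) rep])
  then have "0 < gmax t" by (simp add: fw_type_iteration_def)
  note bt = backtracking_progress[OF st(4) pos(1,2) st(1-3) this]
  show ?case
    unfolding st(5)
    by (rule AdaAFW_or_AdaPFW_iteration(2)[OF alg A pos(5) t st(3) rep bt(2,3)])
qed

lemma fw_type_contraction:
  fixes A :: "'a::euclidean_space set"
  assumes A: "A \<noteq> {}" "bounded A" "\<forall>a. A \<noteq> {a}" and poly: "polytope (convex hull A)"
    and der: "\<And>y. GDERIV f y :> grad y"
    and pos: "\<mu> > 0" "\<epsilon> \<ge> 0" "0 < \<delta>" "\<delta> \<le> 1" "\<tau> > 1" "0 < \<eta>" "Linit > 0"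
    and sc: "strongly_convex_on \<mu> (convex hull A) f"
    and alg: "AdaAFW f grad A \<epsilon> \<delta> \<tau> \<eta> Linit T x d gmax \<gamma> Lest s v S \<alpha> \<or>
       AdaPFW f grad A \<epsilon> \<delta> \<tau> \<eta> Linit T x d gmax \<gamma> Lest s v S \<alpha>"
    and t: "enat t < T" and good: "good_step (gmax t) (\<gamma> t)"
  shows "primal_gap f (convex hull A) (x (Suc t))
    \<le> (1 - \<delta>\<^sup>2 * (\<mu> / (4 * Lest t) * (PWidth A / diameter A)\<^sup>2))
       * primal_gap f (convex hull A) (x t)"
proof -
  let ?D = "convex hull A" and ?g = "(- grad (x t)) \<bullet> d t"
  have run: "ada_run f grad A \<epsilon> \<delta> \<tau> \<eta> Linit T x d gmax \<gamma> Lest"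
    using alg by (auto simp: AdaAFW_def AdaPFW_def)
  obtain a b where ab: "a \<in> A" "b \<in> A" "a \<noteq> b" using A by blast
  obtain Lprev where st: "Lprev > 0" "?g > 0" "d t \<noteq> 0"
    "backtracking f \<tau> \<eta> Lprev (x t) (d t) ?g (gmax t) (Lest t) (\<gamma> t)"
    "x (Suc t) = x t + \<gamma> t *\<^sub>R d t"
    using ada_run_step[OF run pos(5-7) pos(2,3) t] by blast
  note inv = fw_type_run_active_rep[OF alg A(2) pos(5-7) pos(2,3)]
  have rep: "active_rep A (x t) (S t) (\<alpha> t)" and "active_rep A (x (Suc t)) (S (Suc t)) (\<alpha> (Suc t))"
    using inv[of t] inv[of "Suc t"] t by (simp_all add: Suc_ile_eq)
  then have xD: "x t \<in> ?D" and x'D: "x t + \<gamma> t *\<^sub>R d t \<in> ?D"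
    unfolding st(5)[symmetric] by (auto intro: active_rep_in_convex_hull)
  have it: "fw_type_iteration grad A \<delta> (x t) (d t) (gmax t) (S t)"
    by (rule AdaAFW_or_AdaPFW_iteration(1)[OF alg A(2) pos(3) t st(3) rep])
  then have "0 < gmax t" and n: "norm (d t) \<le> diameter A"
    and lin: "\<And>a. a \<in> A \<Longrightarrow> (- grad (x t)) \<bullet> (a - x t) \<le> ?g / \<delta>"
    and pair: "\<And>a u. a \<in> A \<Longrightarrow> u \<in> S t \<Longrightarrow> (- grad (x t)) \<bullet> (a - u) \<le> 2 * (?g / \<delta>)"
    by (auto simp: fw_type_iteration_def)
  note bt = backtracking_progress[OF st(4) pos(5,6) st(1-3) \<open>0 < gmax t\<close>]
  have W: "0 \<le> PWidth A" by (rule PWidth_nonneg[OF A(2) ab])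
  have "(PWidth A)\<^sup>2 * primal_gap f ?D (x t) \<le> (2 * (?g / \<delta>))\<^sup>2 / (2 * \<mu>)"
    using PWidth_dominates_slope[OF A(2) poly active_rep_proper_support[OF rep] xD _ pair W]
    by (rule primal_gap_le_of_slope_bound[OF sc der xD pos(1) W])
  moreover have "(2 * c)\<^sup>2 / (2 * \<mu>) = c\<^sup>2 / (2 * (1 / 4 * \<mu>))" for c
    by (simp add: power_mult_distrib)
  ultimately have gap: "(PWidth A)\<^sup>2 * primal_gap f ?D (x t) \<le> (?g / \<delta>)\<^sup>2 / (2 * (1 / 4 * \<mu>))"
    by (simp only:)
  have lin': "(- grad (x t)) \<bullet> (y - x t) \<le> ?g / \<delta>" if "y \<in> ?D" for y
  proof -
    have "A \<subseteq> {z. (- grad (x t)) \<bullet> z \<le> ?g / \<delta> + (- grad (x t)) \<bullet> x t}"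
      using lin by (fastforce simp: inner_diff_right)
    then have "?D \<subseteq> {z. (- grad (x t)) \<bullet> z \<le> ?g / \<delta> + (- grad (x t)) \<bullet> x t}"
      by (rule hull_minimal) (rule convex_halfspace_le)
    then have "(- grad (x t)) \<bullet> y \<le> ?g / \<delta> + (- grad (x t)) \<bullet> x t" using that by blast
    then show ?thesis by (simp only: inner_diff_right)
  qed
  have "\<gamma> t = ?g / (Lest t * (norm (d t))\<^sup>2) \<or>
      1 \<le> \<gamma> t \<and> primal_gap f ?D (x t) \<le> ?g / \<delta> \<and> PWidth A \<le> diameter A \<and> \<mu> \<le> Lest t
        \<and> (1::real) / 4 \<le> 1 / 2"
    using bt(4)
  proof (rule disj_forward)
    assume eq: "ereal (\<gamma> t) = gmax t"
    then have "\<not> gmax t < 1" using good by (simp add: good_step_def)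
    then have "1 \<le> \<gamma> t" unfolding eq[symmetric] by (simp add: one_ereal_def)
    moreover have "primal_gap f ?D (x t) \<le> ?g / \<delta>"
      by (rule primal_gap_le_linear_gap[OF sc der xD pos(1) lin'])
    moreover have "PWidth A \<le> diameter A" by (rule PWidth_le_diameter[OF A(2) poly ab])
    moreover have "\<mu> \<le> Lest t"
      by (rule strong_convexity_le_accepted_estimate[OF sc der xD x'D bt(2) st(3) bt(5)])
    ultimately show "1 \<le> \<gamma> t \<and> primal_gap f ?D (x t) \<le> ?g / \<delta> \<and> PWidth A \<le> diameter A
        \<and> \<mu> \<le> Lest t \<and> (1::real) / 4 \<le> 1 / 2" by simp
  qed
  moreover have "0 < norm (d t)" "(0::real) < 1 / 4" using st(3) by simp_all
  ultimately have "primal_gap f ?D (x t + \<gamma> t *\<^sub>R d t)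
    \<le> (1 - \<delta>\<^sup>2 * (1 / 4 * \<mu> / Lest t * (PWidth A / diameter A)\<^sup>2)) * primal_gap f ?D (x t)"
    by (intro contraction_of_progress[where x = "x t" and g = ?g and n = "norm (d t)" and \<gamma> = "\<gamma> t"]
        pos(1,3,4) bt(1,6) st(2) W n gap)
  then show ?thesis by (simp add: st(5))
qed

theorem theorem4:
  fixes A :: "'a::euclidean_space set"
    and f :: "'a \<Rightarrow> real" and grad :: "'a \<Rightarrow> 'a"
    and \<mu> L \<epsilon> \<delta> \<tau> \<eta> Linit :: real
    and T :: enat
    and x d s v :: "nat \<Rightarrow> 'a" and gmax :: "nat \<Rightarrow> ereal" and \<gamma> Lest :: "nat \<Rightarrow> real"
    and S :: "nat \<Rightarrow> 'a set" and \<alpha> :: "nat \<Rightarrow> 'a \<Rightarrow> real"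
  assumes "A \<noteq> {}" and "bounded A"
    and "\<And>y. GDERIV f y :> grad y"
    and "\<mu> > 0"
    and "\<epsilon> \<ge> 0" and "0 < \<delta>" and "\<delta> \<le> 1"
    and "\<tau> > 1" and "0 < \<eta>" and "\<eta> \<le> 1" and "Linit > 0"
  shows
    "((\<forall>a. A \<noteq> {a}) \<and> polytope (convex hull A) \<and>
      strongly_convex_on \<mu> (convex hull A) f \<and> lipschitz_on L (convex hull A) grad \<and>
      (AdaAFW f grad A \<epsilon> \<delta> \<tau> \<eta> Linit T x d gmax \<gamma> Lest s v S \<alpha> \<or>
       AdaPFW f grad A \<epsilon> \<delta> \<tau> \<eta> Linit T x d gmax \<gamma> Lest s v S \<alpha>)
      \<longrightarrow> (\<forall>t. enat t < T \<and> good_step (gmax t) (\<gamma> t) \<longrightarrow>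
            primal_gap f (convex hull A) (x (Suc t))
              \<le> (1 - \<delta>\<^sup>2 * (\<mu> / (4 * Lest t) * (PWidth A / diameter A)\<^sup>2))
                 * primal_gap f (convex hull A) (x t)))
   \<and> (A \<noteq> {0} \<and>
      strongly_convex_on \<mu> (span A) f \<and> lipschitz_on L (span A) grad \<and>
      AdaMP f grad A \<epsilon> \<delta> \<tau> \<eta> Linit T x d gmax \<gamma> Lest s
      \<longrightarrow> (\<forall>t. enat t < T \<and> good_step (gmax t) (\<gamma> t) \<longrightarrow>
            primal_gap f (span A) (x (Suc t))
              \<le> (1 - \<delta>\<^sup>2 * (\<mu> / Lest t * (mDW (symmetrize A) / radius (symmetrize A))\<^sup>2))
                 * primal_gap f (span A) (x t)))"
  using fw_type_contraction[OF assms(1,2) _ _ assms(3-9,11)]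
    AdaMP_contraction[OF assms(1,2) _ assms(3-9,11)]
  by blast

end
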